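(* Let $A_0\in\mathbb{R}^{n\times n}$ be Metzler, let $\bar h_1,\ldots,\bar h_N>0$ and let $A_i:[-\bar h_i,0]\to\mathbb{R}^{n\times n}$ be integrable kernels with $A_i(\theta)\ge0$ entrywise for all $\theta\in[-\bar h_i,0]$ (so the system below is positive). Consider $$\dot x(t)=A_0x(t)+\sum_{i=1}^N\int_{-\bar h_i}^0A_i(\theta)x(t+\theta)d\theta,$$ and define $\bar A_i:=\int_{-\bar h_i}^0A_i(\theta)d\theta$. The following statements are equivalent: (i) The system is asymptotically stable. (ii) $A_0+\sum_{i=1}^N\bar A_i$ is Hurwitz stable. (iii) There exists $v\in\mathbb{R}^n_{>0}$ such that $v^T\left(A_0+\sum_{i=1}^N\bar A_i\right)<0$. (iv) $A_0$ is Hurwitz stable and $-\left(\sum_{i=1}^N\bar A_i\right)A_0^{-1}$ is Schur stable. (v) There exist diagonal positive definite $P,Q_1,\ldots,Q_N\in\mathbb{R}^{n\times n}$ such that $$A_0^TP+PA_0+\sum_{i=1}^N\left(Q_i+P\bar A_iQ_i^{-1}\bar A_i^TP\right)\prec0.$$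
   Context: A Metzler matrix has nonnegative off-diagonal entries; vector inequalities are componentwise; $\prec0$ means negative definite; Schur stable means spectral radius less than 1. *)

theory Defs
  imports "HOL-Analysis.Analysis"
begin

text \<open>Matrices are real^'n^'n (n arbitrary but fixed, n = CARD('n)).
  The N delay kernels are indexed by i < N (i.e. 0..N-1 instead of 1..N).\<close>

definition metzler :: "real^'n^'n \<Rightarrow> bool" where
  "metzler M \<longleftrightarrow> (\<forall>i j. i \<noteq> j \<longrightarrow> M $ i $ j \<ge> 0)"

definition cmat :: "real^'n^'n \<Rightarrow> complex^'n^'n" where
  "cmat M = (\<chi> i j. complex_of_real (M $ i $ j))"

definition eigenvalue_c :: "real^'n^'n \<Rightarrow> complex \<Rightarrow> bool" where
  "eigenvalue_c M l \<longleftrightarrow> det ((\<chi> i j. if i = j then l else 0) - cmat M) = 0"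

definition hurwitz :: "real^'n^'n \<Rightarrow> bool" where
  "hurwitz M \<longleftrightarrow> (\<forall>l. eigenvalue_c M l \<longrightarrow> Re l < 0)"

definition schur_stable :: "real^'n^'n \<Rightarrow> bool" where
  "schur_stable M \<longleftrightarrow> (\<forall>l. eigenvalue_c M l \<longrightarrow> cmod l < 1)"

definition diag_posdef :: "real^'n^'n \<Rightarrow> bool" where
  "diag_posdef P \<longleftrightarrow> (\<forall>i j. i \<noteq> j \<longrightarrow> P $ i $ j = 0) \<and> (\<forall>i. P $ i $ i > 0)"

definition neg_def :: "real^'n^'n \<Rightarrow> bool" where
  "neg_def M \<longleftrightarrow> (\<forall>x. x \<noteq> 0 \<longrightarrow> x \<bullet> (M *v x) < 0)"

definition max_delay :: "(nat \<Rightarrow> real) \<Rightarrow> nat \<Rightarrow> real" where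
  "max_delay h N = Max (insert 0 (h ` {..<N}))"

definition is_solution ::
  "real^'n^'n \<Rightarrow> (nat \<Rightarrow> real \<Rightarrow> real^'n^'n) \<Rightarrow> (nat \<Rightarrow> real) \<Rightarrow> nat
     \<Rightarrow> (real \<Rightarrow> real^'n) \<Rightarrow> bool" where
  "is_solution A0 A h N x \<longleftrightarrow>
     continuous_on {- max_delay h N..} x \<and>
     (\<forall>t\<ge>0. (x has_vector_derivative
         (A0 *v x t + (\<Sum>i<N. integral {- h i..0} (\<lambda>\<theta>. A i \<theta> *v x (t + \<theta>)))))
        (at t within {0..}))"

definition asymp_stable ::
  "real^'n^'n \<Rightarrow> (nat \<Rightarrow> real \<Rightarrow> real^'n^'n) \<Rightarrow> (nat \<Rightarrow> real) \<Rightarrow> nat \<Rightarrow> bool" where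
  "asymp_stable A0 A h N \<longleftrightarrow>
     (\<forall>\<epsilon>>0. \<exists>\<delta>>0. \<forall>x. is_solution A0 A h N x \<and>
         (\<forall>\<theta>\<in>{- max_delay h N..0}. norm (x \<theta>) < \<delta>) \<longrightarrow> (\<forall>t\<ge>0. norm (x t) < \<epsilon>)) \<and>
     (\<forall>x. is_solution A0 A h N x \<longrightarrow> (x \<longlongrightarrow> 0) at_top)"

end

theory Submission
  imports Defs
begin

text \<open>Everything reduces to the weight condition (iii). Write \<open>B\<^sub>i = \<integral> A\<^sub>i\<close>. For a Metzler matrix \<open>M\<close> with
  \<open>v\<^sup>T M < 0\<close>, taking absolute values in an eigenvector equation gives Hurwitz stability.
  Conversely the matrices admitting such a \<open>v\<close> form an open set which is also closed among
  nonsingular Metzler matrices, so the condition propagates along every path of nonsingular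
  Metzler matrices. The path \<open>M - l I\<close> gives (iii) from (ii), the path \<open>A\<^sub>0 + (1 - t) \<Sum>\<^sub>i B\<^sub>i\<close> gives (iv),
  and the path of characteristic matrices \<open>A\<^sub>0 + \<Sum>\<^sub>i \<integral> e\<^bsup>l\<theta>\<^esup> A\<^sub>i(\<theta>) d\<theta> - l I\<close>, \<open>l \<ge> 0\<close>, gives (i): a singular
  matrix on it yields a nondecaying solution \<open>e\<^bsup>lt\<^esup> w\<close>. Stability follows by comparison with a
  strict supersolution \<open>e\<^bsup>-\<mu>t\<^esup> w\<close>. For (v), \<open>P = diag(v / w)\<close> and
  \<open>Q\<^sub>i = diag((B\<^sub>i\<^sup>T v + e) / w)\<close>, where \<open>v\<^sup>T M < 0\<close> and \<open>M w < 0\<close>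
  for \<open>M = A\<^sub>0 + \<Sum>\<^sub>i B\<^sub>i\<close>, make the Riccati matrix
  map \<open>w\<close> to a negative vector.\<close>

section \<open>Metzler matrices and positive weights\<close>

text \<open>The functional \<open>x \<mapsto> v \<bullet> x\<close> is then a strict linear Lyapunov
  function on the nonnegative orthant for the system with matrix \<open>M\<close>. All stability
  notions below are compared with this one; for Metzler \<open>M\<close> it says that
  \<open>- M\<close> is a nonsingular M-matrix.\<close>

definition dual_stable :: "real^'n^'n \<Rightarrow> bool" where
  "dual_stable M \<longleftrightarrow> (\<exists>v. (\<forall>j. v $ j > 0) \<and> (\<forall>j. (v v* M) $ j < 0))"

lemma vector_matrix_mult_nth: "(v v* M) $ j = (\<Sum>i\<in>UNIV. v $ i * M $ i $ j)"
  by (simp add: vector_matrix_mult_def)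

lemma matrix_vector_mult_nth: "(M *v x) $ i = (\<Sum>j\<in>UNIV. M $ i $ j * x $ j)"
  by (simp add: matrix_vector_mult_def)

section \<open>Kernels, eigenvectors and transposes\<close>

lemma det_eq_0_iff_ker:
  fixes M :: "'a::field^'n^'n"
  shows "det M = 0 \<longleftrightarrow> (\<exists>x. x \<noteq> 0 \<and> M *v x = 0)"
  using invertible_det_nz[of M] matrix_left_invertible_ker[of M]
  by (auto simp: invertible_left_inverse)

text \<open>The coordinate form allows absolute values to be taken row by row.\<close>

lemma eigenvalue_c_iff:
  "eigenvalue_c M l \<longleftrightarrow> (\<exists>x. x \<noteq> 0 \<and> (\<forall>i. (\<Sum>j\<in>UNIV. of_real (M $ i $ j) * x $ j) = l * x $ i))"
proof -
  have "(((\<chi> i j. if i = j then l else 0) - cmat M) *v x = 0) \<longleftrightarrow>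
      (\<forall>i. (\<Sum>j\<in>UNIV. of_real (M $ i $ j) * x $ j) = l * x $ i)" for x
  proof -
    have "(\<Sum>j\<in>UNIV. (if i = j then l else 0) * x $ j) = l * x $ i" for i
      by (subst sum.cong[OF refl, of _ _ "\<lambda>j. if j = i then l * x $ i else 0"]) auto
    then show ?thesis
      by (auto simp: vec_eq_iff matrix_vector_mult_nth cmat_def left_diff_distrib sum_subtractf)
  qed
  then show ?thesis
    by (simp add: eigenvalue_c_def det_eq_0_iff_ker)
qed

lemma eigenvalue_c_of_real:
  fixes x :: "real^'n"
  assumes "x \<noteq> 0" "M *v x = r *\<^sub>R x"
  shows "eigenvalue_c M (of_real r)"
  unfolding eigenvalue_c_iff
proof (intro exI conjI allI)
  show "(\<chi> i. complex_of_real (x $ i)) \<noteq> 0"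
    using assms(1) by (auto simp: vec_eq_iff)
  have "(\<Sum>j\<in>UNIV. M $ i $ j * x $ j) = r * x $ i" for i
    using arg_cong[OF assms(2), of "\<lambda>y. y $ i"] by (simp add: matrix_vector_mult_nth)
  then show "(\<Sum>j\<in>UNIV. complex_of_real (M $ i $ j) * (\<chi> i. complex_of_real (x $ i)) $ j) =
      complex_of_real r * (\<chi> i. complex_of_real (x $ i)) $ i" for i
    by (simp flip: of_real_mult of_real_sum)
qed

lemma eigenvalue_c_transpose: "eigenvalue_c (transpose M) l = eigenvalue_c M l"
proof -
  have "(\<chi> i j. if i = j then l else 0) - cmat (transpose M) =
      transpose ((\<chi> i j. if i = j then l else 0) - cmat M)"
    by (auto simp: vec_eq_iff cmat_def transpose_def)
  then show ?thesis
    by (simp add: eigenvalue_c_def)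
qed

lemma hurwitz_transpose: "hurwitz (transpose M) = hurwitz M"
  by (simp add: hurwitz_def eigenvalue_c_transpose)

lemma metzler_transpose: "metzler (transpose M) = metzler M"
  by (auto simp: metzler_def transpose_def)

section \<open>Consequences of a positive weight\<close>

lemma sum_vector_matrix_mult:
  fixes M :: "real^'n^'m"
  shows "(\<Sum>i\<in>UNIV. v $ i * (\<Sum>j\<in>UNIV. M $ i $ j * x $ j)) = (\<Sum>j\<in>UNIV. (v v* M) $ j * x $ j)"
  using dot_lmul_matrix[of v M x] by (simp add: inner_vec_def matrix_vector_mult_nth)

lemma sum_neg_of_weights:
  fixes a :: "'n::finite \<Rightarrow> real"
  assumes "\<And>j. a j < 0" "\<And>j. b j \<ge> 0" "\<exists>j. b j \<noteq> 0"
  shows "(\<Sum>j\<in>UNIV. a j * b j) < 0"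
proof -
  obtain k where k: "b k \<noteq> 0" using assms by blast
  have "0 < (\<Sum>j\<in>UNIV. - a j * b j)"
  proof (rule sum_pos2[of _ k])
    show "0 < - a k * b k"
      using k assms(1)[of k] assms(2)[of k] by (simp add: mult_less_0_iff)
    show "0 \<le> - a j * b j" for j
      using assms(1)[of j] assms(2)[of j] by (simp add: mult_le_0_iff)
  qed auto
  then show ?thesis by (simp add: sum_negf)
qed

text \<open>Isolating the diagonal term bounds \<open>cmod (l - M $ i $ i) * cmod (x $ i)\<close> by
  the off-diagonal sum of moduli, and \<open>cmod (l - M $ i $ i)\<close> is at least
  \<open>- M $ i $ i\<close> because \<open>Re l\<close> is nonnegative.\<close>

lemma metzler_eigenvector_abs:
  assumes M: "metzler M" and x: "(\<Sum>j\<in>UNIV. complex_of_real (M $ i $ j) * x $ j) = l * x $ i"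
    and l: "Re l \<ge> 0"
  shows "0 \<le> (\<Sum>j\<in>UNIV. M $ i $ j * cmod (x $ j))"
proof -
  have "(l - of_real (M $ i $ i)) * x $ i = (\<Sum>j\<in>UNIV - {i}. complex_of_real (M $ i $ j) * x $ j)"
    using x sum.remove[of UNIV i "\<lambda>j. complex_of_real (M $ i $ j) * x $ j"]
    by (simp add: left_diff_distrib) (metis add_diff_cancel_left')
  then have "cmod (l - of_real (M $ i $ i)) * cmod (x $ i) \<le>
      (\<Sum>j\<in>UNIV - {i}. cmod (complex_of_real (M $ i $ j) * x $ j))"
    by (simp only: norm_mult[symmetric] norm_sum)
  also have "\<dots> = (\<Sum>j\<in>UNIV - {i}. M $ i $ j * cmod (x $ j))"
    using M by (intro sum.cong) (auto simp: norm_mult metzler_def)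
  finally have *: "cmod (l - of_real (M $ i $ i)) * cmod (x $ i) \<le> \<dots>" .
  have "- M $ i $ i \<le> Re (l - of_real (M $ i $ i))"
    using l by simp
  also have "\<dots> \<le> cmod (l - of_real (M $ i $ i))"
    by (rule complex_Re_le_cmod)
  finally have "- M $ i $ i * cmod (x $ i) \<le> cmod (l - of_real (M $ i $ i)) * cmod (x $ i)"
    by (intro mult_right_mono) auto
  with * show ?thesis
    using sum.remove[of UNIV i "\<lambda>j. M $ i $ j * cmod (x $ j)"] by simp
qed

text \<open>For an eigenvector \<open>x\<close> with \<open>Re l\<close> nonnegative,
  \<open>M\<close> maps the vector of moduli of \<open>x\<close> to a nonnegative vector. Pairing
  with \<open>v\<close> contradicts the negativity of \<open>v v* M\<close>.\<close>

lemma dual_stable_imp_hurwitz: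
  assumes M: "metzler M" and D: "dual_stable M"
  shows "hurwitz M"
  unfolding hurwitz_def
proof (intro allI impI)
  fix l assume "eigenvalue_c M l"
  then obtain x where x: "x \<noteq> 0" "\<And>i. (\<Sum>j\<in>UNIV. of_real (M $ i $ j) * x $ j) = l * x $ i"
    by (auto simp: eigenvalue_c_iff)
  obtain v where v: "\<And>j. v $ j > 0" "\<And>j. (v v* M) $ j < 0"
    using D by (auto simp: dual_stable_def)
  show "Re l < 0"
  proof (rule ccontr)
    assume "\<not> Re l < 0"
    then have abs: "0 \<le> (\<Sum>j\<in>UNIV. M $ i $ j * cmod (x $ j))" for i
      using metzler_eigenvector_abs[OF M x(2)] by simp
    have "0 \<le> (\<Sum>i\<in>UNIV. v $ i * (\<Sum>j\<in>UNIV. M $ i $ j * (\<chi> j. cmod (x $ j)) $ j))"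
    proof (rule sum_nonneg)
      show "0 \<le> v $ i * (\<Sum>j\<in>UNIV. M $ i $ j * (\<chi> j. cmod (x $ j)) $ j)" for i
        using mult_nonneg_nonneg[OF less_imp_le[OF v(1)] abs] by simp
    qed
    also have "\<dots> = (\<Sum>j\<in>UNIV. (v v* M) $ j * cmod (x $ j))"
      unfolding sum_vector_matrix_mult by simp
    also have "\<dots> < 0"
      using v(2) x(1) by (intro sum_neg_of_weights) (auto simp: vec_eq_iff)
    finally show False by simp
  qed
qed

text \<open>Let \<open>c\<close> be the largest number with \<open>c * v\<close> below
  \<open>y\<close>, attained at the index \<open>k\<close>. The nonnegative vector
  \<open>y - c * v\<close> vanishes at \<open>k\<close>, so only off-diagonal entries of column
  \<open>k\<close> act on it and its product with that column is nonnegative. A negative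
  \<open>c\<close> would make this product negative.\<close>

lemma dual_stable_imp_nonneg:
  assumes M: "metzler M" and D: "dual_stable M" and y: "\<And>j. (y v* M) $ j \<le> 0"
  shows "y $ i \<ge> 0"
proof -
  obtain v where v: "\<And>j. v $ j > 0" "\<And>j. (v v* M) $ j < 0"
    using D by (auto simp: dual_stable_def)
  define c where "c = Min (range (\<lambda>i. y $ i / v $ i))"
  have "c \<in> range (\<lambda>i. y $ i / v $ i)"
    unfolding c_def by (intro Min_in) auto
  then obtain k where k: "c = y $ k / v $ k" by auto
  have c: "c * v $ j \<le> y $ j" for j
  proof -
    have "c \<le> y $ j / v $ j" unfolding c_def by (intro Min_le) auto
    then show ?thesis using v(1)[of j] by (simp add: field_simps)
  qed
  have "c \<ge> 0"
  proof (rule ccontr)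
    assume neg: "\<not> c \<ge> 0"
    have yk: "y $ k = c * v $ k" using k v(1)[of k] by (simp add: field_simps)
    have "0 \<le> (\<Sum>j\<in>UNIV. (y $ j - c * v $ j) * M $ j $ k)"
    proof (rule sum_nonneg)
      fix j show "0 \<le> (y $ j - c * v $ j) * M $ j $ k"
        using M c[of j] yk by (cases "j = k") (auto simp: metzler_def)
    qed
    also have "\<dots> = (y v* M) $ k - c * (v v* M) $ k"
      by (simp add: vector_matrix_mult_nth sum_subtractf left_diff_distrib sum_distrib_left mult.assoc)
    also have "\<dots> < 0"
      using y[of k] v(2)[of k] neg by (smt (verit) mult_neg_neg)
    finally show False by simp
  qed
  then show ?thesis
    using c[of i] v(1)[of i] by (smt (verit) mult_nonneg_nonneg)
qed

text \<open>At a zero of \<open>y\<close> the diagonal entry of that column drops out, leaving a sum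
  of nonnegative terms.\<close>

lemma metzler_positive_of_neg:
  assumes M: "metzler M" and y: "\<And>i. y $ i \<ge> 0" and neg: "\<And>j. (y v* M) $ j < 0"
  shows "y $ i > 0"
proof (rule ccontr)
  assume "\<not> y $ i > 0"
  then have "y $ i = 0" using y[of i] by simp
  then have "0 \<le> (y v* M) $ i"
    unfolding vector_matrix_mult_nth using M y
    by (intro sum_nonneg) (metis mult_nonneg_nonneg metzler_def mult_zero_left order_refl)
  then show False using neg[of i] by simp
qed

lemma dual_stable_imp_positive:
  assumes "metzler M" "dual_stable M" "\<And>j. (y v* M) $ j < 0"
  shows "y $ i > 0"
  using metzler_positive_of_neg[OF assms(1) dual_stable_imp_nonneg[OF assms(1,2)] assms(3)] assms(3)
  by (meson less_imp_le)

section \<open>Openness, closedness and propagation along paths\<close>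

lemma open_vec_mult_neg: "open {M::real^'n^'m. \<forall>j. (v v* M) $ j < 0}"
proof -
  have "{M::real^'n^'m. \<forall>j. (v v* M) $ j < 0} = (\<Inter>j. {M. (\<Sum>i\<in>UNIV. v $ i * M $ i $ j) < 0})"
    by (auto simp: vector_matrix_mult_nth)
  moreover have "open {M::real^'n^'m. (\<Sum>i\<in>UNIV. v $ i * M $ i $ j) < 0}" for j
    by (intro open_Collect_less continuous_intros)
  ultimately show ?thesis by auto
qed

lemma open_dual_stable: "open {M::real^'n^'n. dual_stable M}"
proof -
  have "{M::real^'n^'n. dual_stable M} = (\<Union>v\<in>{v. \<forall>j. v $ j > 0}. {M. \<forall>j. (v v* M) $ j < 0})"
    by (auto simp: dual_stable_def)
  then show ?thesis by (auto intro!: open_UN open_vec_mult_neg)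
qed

text \<open>The solution \<open>y\<close> of \<open>y\<^sup>T M = -1\<close> is positive because \<open>y\<^sup>T M' < 0\<close> persists for
  the nearby \<open>M'\<close>, so no continuity of the matrix inverse is needed.\<close>

lemma dual_stable_closure:
  fixes M :: "real^'n^'n"
  assumes M: "metzler M" and det: "det M \<noteq> 0" and cl: "M \<in> closure {M'. metzler M' \<and> dual_stable M'}"
  shows "dual_stable M"
proof -
  obtain B where B: "B ** M = mat 1"
    using det invertible_det_nz invertible_left_inverse by blast
  define y where "y = (\<chi> j. -1) v* B"
  have y: "y v* M = (\<chi> j. -1)"
    by (simp add: y_def vector_matrix_mul_assoc B)
  define U where "U = {M'::real^'n^'n. \<forall>j. (y v* M') $ j < 0}"
  have "open U" "M \<in> U"
    by (auto simp: U_def open_vec_mult_neg y)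
  then obtain M' where M': "metzler M'" "dual_stable M'" "M' \<in> U"
    using cl open_Int_closure_eq_empty[of U "{M'. metzler M' \<and> dual_stable M'}"] by blast
  have "y $ i > 0" for i
    using dual_stable_imp_positive[OF M'(1,2)] M'(3) by (auto simp: U_def)
  then show ?thesis
    unfolding dual_stable_def by (intro exI[of _ y]) (auto simp: y)
qed

text \<open>A connectedness argument: along the path the weight condition is both open and closed,
  and it holds at the endpoint \<open>b\<close>.\<close>

lemma dual_stable_path:
  fixes B :: "real \<Rightarrow> real^'n^'n"
  assumes cont: "continuous_on {0..b} B" and b: "b \<ge> 0"
    and M: "\<And>t. t \<in> {0..b} \<Longrightarrow> metzler (B t)"
    and det: "\<And>t. t \<in> {0..b} \<Longrightarrow> det (B t) \<noteq> 0"
    and D: "dual_stable (B b)"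
  shows "dual_stable (B 0)"
proof -
  define C where "C = B ` {0..b}"
  \<comment> \<open>Taking the complement of the closure makes \<open>V\<close> open by
    construction. That \<open>V\<close> and the dual stable matrices together cover the path is
    where \<open>dual_stable_closure\<close>, and so nonsingularity, enters.\<close>
  define V where "V = - closure {M'::real^'n^'n. metzler M' \<and> dual_stable M'}"
  have conn: "connected C"
    unfolding C_def by (intro connected_continuous_image cont) auto
  have op: "open {M::real^'n^'n. dual_stable M}" "open V"
    unfolding V_def by (auto simp: open_dual_stable)
  have cov: "C \<subseteq> {M. dual_stable M} \<union> V"
  proof
    fix X assume "X \<in> C"
    then have "metzler X" "det X \<noteq> 0" using M det by (auto simp: C_def)
    then show "X \<in> {M. dual_stable M} \<union> V"
      using dual_stable_closure[of X] by (auto simp: V_def)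
  qed
  have disj: "{M. dual_stable M} \<inter> V \<inter> C = {}"
  proof -
    have "B t \<in> closure {M'. metzler M' \<and> dual_stable M'}" if "t \<in> {0..b}" "dual_stable (B t)" for t
      by (rule subsetD[OF closure_subset]) (use that M in simp)
    then show ?thesis
      by (auto simp: V_def C_def)
  qed
  have "B b \<in> {M. dual_stable M} \<inter> C"
    using D b by (auto simp: C_def)
  then have "V \<inter> C = {}"
    using connectedD[OF conn op disj cov] by blast
  then show ?thesis
    using cov b by (force simp: C_def)
qed

section \<open>Shifts by multiples of the identity\<close>

lemma mat_vector_mult_real: "(M - r *\<^sub>R mat 1) *v x = M *v x - r *\<^sub>R (x :: real^'n)"
  by (simp add: matrix_vector_mult_diff_rdistrib scaleR_matrix_vector_assoc[symmetric])

lemma metzler_minus_mat: "metzler M \<Longrightarrow> metzler (M - r *\<^sub>R mat 1)"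
  by (auto simp: metzler_def mat_def)

text \<open>The weight is the all-ones vector, for which the condition says that all column sums are
  negative.\<close>

lemma dual_stable_minus_mat:
  fixes M :: "real^'n^'n"
  assumes "\<And>j. r > (\<Sum>i\<in>UNIV. M $ i $ j)"
  shows "dual_stable (M - r *\<^sub>R mat 1)"
  unfolding dual_stable_def
proof (intro exI conjI allI)
  fix j
  have "((\<chi> i. 1) v* (M - r *\<^sub>R mat 1)) $ j = (\<Sum>i\<in>UNIV. M $ i $ j - (if i = j then r else 0))"
    unfolding vector_matrix_mult_nth by (intro sum.cong) (auto simp: mat_def)
  also have "\<dots> < 0"
    using assms[of j] by (simp add: sum_subtractf)
  finally show "((\<chi> i. 1) v* (M - r *\<^sub>R mat 1)) $ j < 0" .
qed simp

lemma ex_bound_column_sums: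
  fixes M :: "real^'n^'n"
  shows "\<exists>r\<ge>0. \<forall>j. r > (\<Sum>i\<in>UNIV. M $ i $ j)"
proof -
  define r where "r = (\<Sum>j\<in>UNIV. \<bar>\<Sum>i\<in>UNIV. M $ i $ j\<bar>) + 1"
  have "(\<Sum>i\<in>UNIV. M $ i $ j) < r" for j
    using member_le_sum[of j UNIV "\<lambda>j. \<bar>\<Sum>i\<in>UNIV. M $ i $ j\<bar>"] by (auto simp: r_def)
  moreover have "r \<ge> 0" by (auto simp: r_def sum_nonneg add_nonneg_nonneg)
  ultimately show ?thesis by blast
qed

text \<open>The path \<open>M - r I\<close> runs from a large shift, where column sums are negative,
  down to \<open>r = 0\<close>; it is singular exactly at real eigenvalues of \<open>M\<close>. The
  criterion serves both Hurwitz matrices and the Riccati inequality.\<close>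

lemma dual_stable_of_no_real_eigenvalue:
  fixes M :: "real^'n^'n"
  assumes M: "metzler M" and ev: "\<And>r x. r \<ge> 0 \<Longrightarrow> x \<noteq> 0 \<Longrightarrow> M *v x \<noteq> r *\<^sub>R x"
  shows "dual_stable M"
proof -
  obtain b where b: "b \<ge> 0" "\<And>j. b > (\<Sum>i\<in>UNIV. M $ i $ j)"
    using ex_bound_column_sums by metis
  have "dual_stable (M - 0 *\<^sub>R mat 1)"
  proof (rule dual_stable_path[where b = b and B = "\<lambda>r. M - r *\<^sub>R mat 1"])
    show "det (M - t *\<^sub>R mat 1) \<noteq> 0" if "t \<in> {0..b}" for t
      using ev[of t] that by (auto simp: det_eq_0_iff_ker mat_vector_mult_real)
    show "continuous_on {0..b} (\<lambda>r. M - r *\<^sub>R mat 1)"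
      by (intro continuous_intros)
  qed (use b M in \<open>simp_all add: metzler_minus_mat dual_stable_minus_mat\<close>)
  then show ?thesis by simp
qed

lemma hurwitz_iff_dual_stable:
  fixes M :: "real^'n^'n"
  assumes M: "metzler M"
  shows "hurwitz M \<longleftrightarrow> dual_stable M"
proof
  assume H: "hurwitz M"
  show "dual_stable M"
  proof (rule dual_stable_of_no_real_eigenvalue[OF M])
    fix r :: real and x :: "real^'n" assume "r \<ge> 0" "x \<noteq> 0"
    then show "M *v x \<noteq> r *\<^sub>R x"
      using H eigenvalue_c_of_real[of x M r] by (force simp: hurwitz_def)
  qed
qed (rule dual_stable_imp_hurwitz[OF M])

section \<open>The spectral radius criterion\<close>

lemma matrix_inv_mult:
  fixes M :: "real^'n^'n"
  assumes "det M \<noteq> 0"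
  shows "M ** matrix_inv M = mat 1" "matrix_inv M ** M = mat 1"
proof -
  have "\<exists>B. M ** B = mat 1 \<and> B ** M = mat 1"
    using assms by (simp add: invertible_det_nz[symmetric] invertible_def)
  then have "M ** matrix_inv M = mat 1 \<and> matrix_inv M ** M = mat 1"
    unfolding matrix_inv_def by (rule someI_ex)
  then show "M ** matrix_inv M = mat 1" "matrix_inv M ** M = mat 1"
    by auto
qed

lemma hurwitz_imp_det_nz:
  assumes "hurwitz M"
  shows "det M \<noteq> 0"
proof
  assume "det M = 0"
  then obtain x where "x \<noteq> 0" "M *v x = 0"
    by (auto simp: det_eq_0_iff_ker)
  then have "eigenvalue_c M (of_real 0)"
    by (intro eigenvalue_c_of_real[of x]) auto
  then show False
    using assms by (auto simp: hurwitz_def)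
qed

text \<open>For an eigenvector, \<open>cmod l\<close> times the vector of moduli is at most
  \<open>T\<close> applied to that vector. Pairing with \<open>v\<close> gives a strict contraction
  in the \<open>v\<close>-weighted l1 norm.\<close>

lemma schur_stable_of_weights:
  fixes T :: "real^'n^'n"
  assumes T: "\<And>i j. T $ i $ j \<ge> 0" and v: "\<And>j. v $ j > 0" and vT: "\<And>j. (v v* T) $ j < v $ j"
  shows "schur_stable T"
  unfolding schur_stable_def
proof (intro allI impI)
  fix l assume "eigenvalue_c T l"
  then obtain x where x: "x \<noteq> 0" "\<And>i. (\<Sum>j\<in>UNIV. of_real (T $ i $ j) * x $ j) = l * x $ i"
    by (auto simp: eigenvalue_c_iff)
  have le: "cmod l * cmod (x $ i) \<le> (\<Sum>j\<in>UNIV. T $ i $ j * (\<chi> j. cmod (x $ j)) $ j)" for i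
  proof -
    have "cmod l * cmod (x $ i) = cmod (\<Sum>j\<in>UNIV. of_real (T $ i $ j) * x $ j)"
      by (simp add: x norm_mult)
    also have "\<dots> \<le> (\<Sum>j\<in>UNIV. cmod (of_real (T $ i $ j) * x $ j))"
      by (rule norm_sum)
    also have "\<dots> = (\<Sum>j\<in>UNIV. T $ i $ j * (\<chi> j. cmod (x $ j)) $ j)"
      by (simp add: norm_mult T)
    finally show ?thesis .
  qed
  have "(\<Sum>i\<in>UNIV. v $ i * (cmod l * cmod (x $ i))) \<le>
      (\<Sum>i\<in>UNIV. v $ i * (\<Sum>j\<in>UNIV. T $ i $ j * (\<chi> j. cmod (x $ j)) $ j))"
    by (rule sum_mono, rule mult_left_mono[OF le less_imp_le[OF v]])
  also have "\<dots> = (\<Sum>j\<in>UNIV. (v v* T) $ j * cmod (x $ j))"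
    unfolding sum_vector_matrix_mult by simp
  finally have 1: "(\<Sum>i\<in>UNIV. v $ i * (cmod l * cmod (x $ i))) \<le> \<dots>" .
  have "(\<Sum>j\<in>UNIV. ((v v* T) $ j - v $ j) * cmod (x $ j)) < 0"
    using vT x(1) by (intro sum_neg_of_weights) (auto simp: vec_eq_iff)
  with 1 have 2: "(\<Sum>i\<in>UNIV. v $ i * (cmod l * cmod (x $ i))) < (\<Sum>i\<in>UNIV. v $ i * cmod (x $ i))"
    by (simp add: left_diff_distrib sum_subtractf)
  show "cmod l < 1"
  proof (rule ccontr)
    assume "\<not> cmod l < 1"
    then have "cmod (x $ i) \<le> cmod l * cmod (x $ i)" for i
      using mult_right_mono[of 1 "cmod l" "cmod (x $ i)"] by simp
    then have "(\<Sum>i\<in>UNIV. v $ i * cmod (x $ i)) \<le> (\<Sum>i\<in>UNIV. v $ i * (cmod l * cmod (x $ i)))"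
      by (intro sum_mono mult_left_mono less_imp_le[OF v])
    with 2 show False by simp
  qed
qed

text \<open>Row \<open>i\<close> of the inverse solves \<open>y v* A = axis i 1\<close>, so
  \<open>- y\<close> meets the hypothesis of \<open>dual_stable_imp_nonneg\<close>.\<close>

lemma metzler_matrix_inv_nonpos:
  fixes A :: "real^'n^'n"
  assumes A: "metzler A" and D: "dual_stable A"
  shows "matrix_inv A $ i $ j \<le> 0"
proof -
  have det: "det A \<noteq> 0"
    using dual_stable_imp_hurwitz[OF A D] by (rule hurwitz_imp_det_nz)
  define y where "y = axis i 1 v* matrix_inv A"
  have "y v* A = axis i 1"
    by (simp add: y_def vector_matrix_mul_assoc matrix_inv_mult[OF det])
  then have "((- y) v* A) $ k \<le> 0" for k
    by (simp add: vector_matrix_mult_nth sum_negf vec_eq_iff axis_def)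
  then have "(- y) $ j \<ge> 0"
    by (rule dual_stable_imp_nonneg[OF A D])
  moreover have "y $ j = matrix_inv A $ i $ j"
    by (simp add: y_def vector_matrix_mult_nth axis_def if_distrib[of "\<lambda>x. x * _"] cong: if_cong)
  ultimately show ?thesis by simp
qed

text \<open>Put \<open>T = - (S ** matrix_inv A)\<close>. Forward, a weight \<open>v\<close> for
  \<open>A + S\<close> is also one for \<open>A\<close>, and \<open>v - v v* T\<close> equals
  \<open>v v* (A + S) v* matrix_inv A\<close>, which is positive by inverse positivity. Backward, a
  singular \<open>A + (1 - t) S\<close> would give \<open>T\<close> the eigenvalue
  \<open>1 / (1 - t)\<close>, at least 1.\<close>

lemma hurwitz_add_iff:
  fixes A S :: "real^'n^'n"
  assumes A: "metzler A" and S: "\<And>i j. S $ i $ j \<ge> 0"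
  shows "hurwitz (A + S) \<longleftrightarrow> hurwitz A \<and> schur_stable (- (S ** matrix_inv A))"
proof -
  have metz: "metzler (A + t *\<^sub>R S)" if "t \<ge> 0" for t
    using A S that by (auto simp: metzler_def)
  then have AS: "metzler (A + S)" by (metis scaleR_one zero_le_one)
  define T where "T = - (S ** matrix_inv A)"
  show ?thesis
  proof (intro iffI conjI)
    assume "hurwitz (A + S)"
    then obtain v where v: "\<And>j. v $ j > 0" "\<And>j. (v v* (A + S)) $ j < 0"
      using hurwitz_iff_dual_stable[OF AS] by (auto simp: dual_stable_def)
    have vS: "(v v* S) $ j \<ge> 0" for j
      unfolding vector_matrix_mult_nth by (intro sum_nonneg mult_nonneg_nonneg S less_imp_le[OF v(1)])
    have "(v v* A) $ j < 0" for j
      using v(2)[of j] vS[of j] by (simp add: vector_matrix_mult_add_rdistrib)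
    then have D: "dual_stable A"
      using v(1) by (auto simp: dual_stable_def)
    then show HA: "hurwitz A" by (rule dual_stable_imp_hurwitz[OF A])
    note inv = matrix_inv_mult[OF hurwitz_imp_det_nz[OF HA]]
    have vAS: "v v* (A + S) v* matrix_inv A = v + v v* (S ** matrix_inv A)"
      by (simp add: vector_matrix_mult_add_rdistrib vector_matrix_left_distrib vector_matrix_mul_assoc inv)
    have pos: "(v v* (A + S) v* matrix_inv A) $ j > 0" for j
    proof (rule dual_stable_imp_positive[OF A D])
      show "(v v* (A + S) v* matrix_inv A v* A) $ j < 0" for j
        using v(2)[of j] by (simp add: vector_matrix_mul_assoc[of _ "matrix_inv A"] inv)
    qed
    have vT: "v v* T = - (v v* (S ** matrix_inv A))"
      by (simp add: T_def vec_eq_iff vector_matrix_mult_nth sum_negf)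
    show "schur_stable (- (S ** matrix_inv A))"
      unfolding T_def[symmetric]
    proof (rule schur_stable_of_weights)
      show "T $ i $ j \<ge> 0" for i j
        by (auto simp: T_def matrix_matrix_mult_def intro!: sum_nonpos mult_nonneg_nonpos S
            metzler_matrix_inv_nonpos[OF A D])
      show "(v v* T) $ j < v $ j" for j
        using pos[of j] by (simp add: vAS vT)
    qed (rule v(1))
  next
    assume H: "hurwitz A \<and> schur_stable (- (S ** matrix_inv A))"
    note inv = matrix_inv_mult[OF hurwitz_imp_det_nz[OF conjunct1[OF H]]]
    have "dual_stable (A + (1 - 0) *\<^sub>R S)"
    \<comment> \<open>The parameter is reversed because propagation goes from \<open>b\<close> to 0:
      the path ends at \<open>A\<close>, where stability is known, and starts at
      \<open>A + S\<close>.\<close>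
    proof (rule dual_stable_path[where b = 1 and B = "\<lambda>t. A + (1 - t) *\<^sub>R S"])
      show "continuous_on {0..1} (\<lambda>t. A + (1 - t) *\<^sub>R S)"
        by (intro continuous_intros)
      show "dual_stable (A + (1 - 1) *\<^sub>R S)"
        using H hurwitz_iff_dual_stable[OF A] by simp
      fix t :: real assume t: "t \<in> {0..1}"
      show "metzler (A + (1 - t) *\<^sub>R S)"
        using t by (intro metz) auto
      show "det (A + (1 - t) *\<^sub>R S) \<noteq> 0"
      proof
        assume "det (A + (1 - t) *\<^sub>R S) = 0"
        then obtain x where x: "x \<noteq> 0" "A *v x + (1 - t) *\<^sub>R (S *v x) = 0"
          by (auto simp: det_eq_0_iff_ker matrix_vector_mult_add_rdistrib scaleR_matrix_vector_assoc)
        \<comment> \<open>Applying \<open>A\<close> turns a kernel vector of the sum into an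
          eigenvector of \<open>T\<close>, since \<open>T *v y = - (S *v x)\<close>.\<close>
        define y where "y = A *v x"
        have xy: "x = matrix_inv A *v y"
          by (simp add: y_def matrix_vector_mul_assoc inv)
        then have "y \<noteq> 0" using x(1) by auto
        have t1: "t \<noteq> 1"
          using x \<open>y \<noteq> 0\<close> by (auto simp: y_def)
        have Ty: "T *v y = - (S *v x)"
          unfolding T_def xy matrix_vector_mul_assoc
          by (simp add: vec_eq_iff matrix_vector_mult_nth sum_negf)
        have "y = - ((1 - t) *\<^sub>R (S *v x))"
          unfolding y_def eq_neg_iff_add_eq_0 by (rule x(2))
        then have "inverse (1 - t) *\<^sub>R y = - (S *v x)"
          using t1 by simp
        then have "T *v y = inverse (1 - t) *\<^sub>R y"
          by (simp only: Ty)
        from eigenvalue_c_of_real[OF \<open>y \<noteq> 0\<close> this]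
        have "cmod (of_real (inverse (1 - t))) < 1"
          using H unfolding schur_stable_def T_def[symmetric] by blast
        moreover have "inverse (1 - t) \<ge> 1"
          using t t1 by (simp add: field_simps)
        ultimately show False by (simp only: norm_of_real)
      qed
    qed simp
    then show "hurwitz (A + S)"
      using hurwitz_iff_dual_stable[OF AS] by simp
  qed
qed

section \<open>The Riccati inequality\<close>

definition diagm :: "real^'n \<Rightarrow> real^'n^'n" where
  "diagm d = (\<chi> i j. if i = j then d $ i else 0)"

lemma diagm_mult_vec: "(diagm d *v x) $ i = d $ i * x $ i"
proof -
  have "(diagm d *v x) $ i = (\<Sum>j\<in>UNIV. if i = j then d $ i * x $ j else 0)"
    unfolding matrix_vector_mult_nth by (intro sum.cong) (auto simp: diagm_def)
  then show ?thesis by simp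
qed

lemma diagm_mult_left: "(diagm d ** M) $ i $ j = d $ i * M $ i $ j"
proof -
  have "(diagm d ** M) $ i $ j = (\<Sum>k\<in>UNIV. if i = k then d $ i * M $ k $ j else 0)"
    unfolding matrix_matrix_mult_def vec_lambda_beta by (intro sum.cong) (auto simp: diagm_def)
  then show ?thesis by simp
qed

lemma diagm_mult_right: "(M ** diagm d) $ i $ j = M $ i $ j * d $ j"
proof -
  have "(M ** diagm d) $ i $ j = (\<Sum>k\<in>UNIV. if k = j then M $ i $ k * d $ k else 0)"
    unfolding matrix_matrix_mult_def vec_lambda_beta by (intro sum.cong) (auto simp: diagm_def)
  then show ?thesis by simp
qed

lemma diag_posdef_iff: "diag_posdef P \<longleftrightarrow> (\<exists>d. (\<forall>i. d $ i > 0) \<and> P = diagm d)"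
proof
  assume "diag_posdef P"
  then show "\<exists>d. (\<forall>i. d $ i > 0) \<and> P = diagm d"
    by (intro exI[of _ "\<chi> i. P $ i $ i"]) (auto simp: diag_posdef_def diagm_def vec_eq_iff)
qed (auto simp: diag_posdef_def diagm_def)

lemma matrix_inv_diagm:
  assumes "\<And>i. d $ i \<noteq> 0"
  shows "matrix_inv (diagm d) = diagm (\<chi> i. inverse (d $ i))"
proof -
  let ?E = "diagm (\<chi> i. inverse (d $ i))"
  have 1: "diagm d ** ?E = mat 1"
    unfolding vec_eq_iff diagm_mult_left using assms by (auto simp: diagm_def mat_def)
  then have "det (diagm d) \<noteq> 0"
    using invertible_det_nz invertible_right_inverse by blast
  then have "matrix_inv (diagm d) ** (diagm d ** ?E) = ?E"
    by (simp add: matrix_mul_assoc matrix_inv_mult)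
  then show ?thesis by (simp add: 1)
qed

text \<open>The weights \<open>w\<close> split each off-diagonal term as
  \<open>x\<^sub>i x\<^sub>j \<le> (x\<^sub>i\<^sup>2 w\<^sub>j / w\<^sub>i + x\<^sub>j\<^sup>2 w\<^sub>i / w\<^sub>j) / 2\<close>.\<close>

lemma symmetric_metzler_neg_def:
  fixes R :: "real^'n^'n"
  assumes R: "metzler R" and sym: "\<And>i j. R $ i $ j = R $ j $ i"
    and w: "\<And>i. w $ i > 0" and Rw: "\<And>i. (R *v w) $ i < 0"
  shows "neg_def R"
  unfolding neg_def_def
proof (intro allI impI)
  fix x :: "real^'n" assume x: "x \<noteq> 0"
  define s where "s i j = R $ i $ j * w $ j * ((x $ i)\<^sup>2 / w $ i)" for i j
  have le: "x $ i * (R $ i $ j * x $ j) \<le> (s i j + s j i) / 2" for i j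
  proof (cases "i = j")
    case True
    then show ?thesis using w[of i] by (simp add: s_def power2_eq_square)
  next
    case False
    have "0 \<le> (x $ i * w $ j - x $ j * w $ i)\<^sup>2 / (w $ i * w $ j)"
      using w[of i] w[of j] by simp
    also have "\<dots> = w $ j * ((x $ i)\<^sup>2 / w $ i) + w $ i * ((x $ j)\<^sup>2 / w $ j) - 2 * (x $ i * x $ j)"
      using w[of i] w[of j] by (simp add: field_simps power2_eq_square)
    finally have "2 * (x $ i * x $ j) \<le> w $ j * ((x $ i)\<^sup>2 / w $ i) + w $ i * ((x $ j)\<^sup>2 / w $ j)"
      by simp
    from mult_left_mono[OF this, of "R $ i $ j"] R False
    have "R $ i $ j * (2 * (x $ i * x $ j)) \<le>
        R $ i $ j * (w $ j * ((x $ i)\<^sup>2 / w $ i) + w $ i * ((x $ j)\<^sup>2 / w $ j))"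
      by (simp add: metzler_def)
    also have "\<dots> = s i j + s j i"
      using sym[of i j] by (simp add: s_def distrib_left mult.assoc)
    finally show ?thesis by (simp add: mult_ac)
  qed
  have "x \<bullet> (R *v x) = (\<Sum>i\<in>UNIV. \<Sum>j\<in>UNIV. x $ i * (R $ i $ j * x $ j))"
    by (simp add: inner_vec_def matrix_vector_mult_nth sum_distrib_left)
  also have "\<dots> \<le> (\<Sum>i\<in>UNIV. \<Sum>j\<in>UNIV. (s i j + s j i) / 2)"
    by (intro sum_mono le)
  \<comment> \<open>The double sum is invariant under exchanging \<open>i\<close> and
    \<open>j\<close>, so both halves contribute equally.\<close>
  also have "\<dots> = (\<Sum>i\<in>UNIV. \<Sum>j\<in>UNIV. s i j)"
    using sum.swap[of s UNIV UNIV] by (simp add: sum.distrib add_divide_distrib sum_divide_distrib[symmetric])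
  also have "\<dots> = (\<Sum>i\<in>UNIV. (R *v w) $ i * ((x $ i)\<^sup>2 / w $ i))"
    by (simp add: s_def matrix_vector_mult_nth sum_distrib_right sum_divide_distrib)
  also have "\<dots> < 0"
  proof (rule sum_neg_of_weights[OF Rw])
    show "0 \<le> (x $ j)\<^sup>2 / w $ j" for j
      by (simp add: less_imp_le[OF w])
    obtain k where "x $ k \<noteq> 0" using x by (auto simp: vec_eq_iff)
    then have "(x $ k)\<^sup>2 / w $ k \<noteq> 0" using w[of k] by simp
    then show "\<exists>j. (x $ j)\<^sup>2 / w $ j \<noteq> 0" ..
  qed
  finally show "x \<bullet> (R *v x) < 0" .
qed

text \<open>The matrix of condition (v) with \<open>P\<close> and \<open>Q i\<close> given by their
  diagonals. Reciprocals in place of \<open>matrix_inv\<close> keep every entry explicit.\<close>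

definition riccati ::
  "real^'n^'n \<Rightarrow> (nat \<Rightarrow> real^'n^'n) \<Rightarrow> nat \<Rightarrow> real^'n \<Rightarrow> (nat \<Rightarrow> real^'n) \<Rightarrow> real^'n^'n" where
  "riccati A S N p q = transpose A ** diagm p + diagm p ** A +
     (\<Sum>i<N. diagm (q i) + diagm p ** S i ** diagm (\<chi> k. inverse (q i $ k)) ** transpose (S i) ** diagm p)"

lemma matrix_vector_mult_sum: "(\<Sum>i\<in>I. M i) *v x = (\<Sum>i\<in>I. M i *v x)"
  by (induction I rule: infinite_finite_induct) (auto simp: matrix_vector_mult_add_rdistrib)

lemma riccati_mult_vec:
  "(riccati A S N p q *v x) $ k = ((diagm p *v x) v* A) $ k + p $ k * (A *v x) $ k +
    (\<Sum>i<N. q i $ k * x $ k +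
      p $ k * (S i *v (diagm (\<chi> k. inverse (q i $ k)) *v ((diagm p *v x) v* S i))) $ k)"
  by (simp add: riccati_def matrix_vector_mult_add_rdistrib matrix_vector_mult_sum diagm_mult_vec
      flip: matrix_vector_mul_assoc)

lemma riccati_sym: "riccati A S N p q $ i $ j = riccati A S N p q $ j $ i"
proof -
  have "transpose (riccati A S N p q) = riccati A S N p q"
  proof -
    have tr: "transpose (diagm d) = diagm d" for d :: "real^'n"
      by (auto simp: diagm_def transpose_def vec_eq_iff)
    have add: "transpose (X + Y) = transpose X + transpose Y" for X Y :: "real^'n^'n"
      by (simp add: transpose_def vec_eq_iff)
    have sum: "transpose (\<Sum>i\<in>I. F i) = (\<Sum>i\<in>I. transpose (F i))" for I and F :: "nat \<Rightarrow> real^'n^'n"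
      by (simp add: transpose_def vec_eq_iff)
    show ?thesis
      by (simp add: riccati_def add sum tr matrix_transpose_mul matrix_mul_assoc add.commute)
  qed
  from arg_cong[OF this, of "\<lambda>X. X $ j $ i"] show ?thesis
    by (simp add: transpose_def)
qed

lemma metzler_riccati:
  fixes A :: "real^'n^'n"
  assumes A: "metzler A" and S: "\<And>i j k. i < N \<Longrightarrow> S i $ j $ k \<ge> 0"
    and p: "\<And>k. p $ k > 0" and q: "\<And>i k. i < N \<Longrightarrow> q i $ k > 0"
  shows "metzler (riccati A S N p q)"
  unfolding metzler_def
proof (intro allI impI)
  fix j k :: 'n assume jk: "j \<noteq> k"
  have "0 \<le> (diagm (q i) + diagm p ** S i ** diagm (\<chi> k. inverse (q i $ k)) ** transpose (S i) ** diagm p) $ j $ k"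
    if i: "i < N" for i
  proof -
    have "0 \<le> (diagm p ** S i ** diagm (\<chi> k. inverse (q i $ k)) ** transpose (S i)) $ j $ k"
      unfolding matrix_matrix_mult_def[of _ "transpose (S i)"]
      by (auto simp: diagm_mult_right diagm_mult_left transpose_def less_imp_le[OF p] less_imp_le[OF q[OF i]] S[OF i]
          intro!: sum_nonneg)
    then show ?thesis
      using jk by (simp add: diagm_mult_right less_imp_le[OF p] diagm_def[of "q i"])
  qed
  then have "0 \<le> (\<Sum>i<N. (diagm (q i) + diagm p ** S i ** diagm (\<chi> k. inverse (q i $ k)) ** transpose (S i) ** diagm p) $ j $ k)"
    by (intro sum_nonneg) auto
  moreover have "0 \<le> (transpose A ** diagm p + diagm p ** A) $ j $ k"
    using A jk by (simp add: diagm_mult_right diagm_mult_left transpose_def metzler_def less_imp_le[OF p])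
  ultimately show "0 \<le> riccati A S N p q $ j $ k"
    by (simp add: riccati_def)
qed

text \<open>With \<open>p = v / w\<close>, \<open>diagm p\<close> maps \<open>w\<close> to
  \<open>v\<close>. The choice of \<open>q\<close> gives \<open>q i * w = v v* S i + e\<close>,
  while the inverse weight sends \<open>v v* S i\<close> to a vector below \<open>w\<close>. So the
  Riccati matrix maps \<open>w\<close> to at most \<open>v v* M + N e + p * (M *v w)\<close> with
  \<open>M = A + (\<Sum>i<N. S i)\<close>.\<close>

lemma ex_riccati_neg_def:
  fixes A :: "real^'n^'n"
  assumes A: "metzler A" and S: "\<And>i j k. i < N \<Longrightarrow> S i $ j $ k \<ge> 0"
    and v: "\<And>k. v $ k > 0" "\<And>k. (v v* (A + (\<Sum>i<N. S i))) $ k < 0"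
    and w: "\<And>k. w $ k > 0" "\<And>k. ((A + (\<Sum>i<N. S i)) *v w) $ k < 0"
  shows "\<exists>p q. (\<forall>k. p $ k > 0) \<and> (\<forall>i<N. \<forall>k. q i $ k > 0) \<and> neg_def (riccati A S N p q)"
proof -
  define p where "p = (\<chi> k. v $ k / w $ k)"
  define r where "r k = (v v* (A + (\<Sum>i<N. S i))) $ k" for k
  \<comment> \<open>The padding \<open>e\<close> keeps each \<open>q i\<close> positive where
    \<open>v v* S i\<close> vanishes. Its \<open>N\<close> copies must fit into the slack of
    \<open>v\<close>; the divisor \<open>N + 1\<close> also covers \<open>N = 0\<close>.\<close>
  define e where "e = Min (range (\<lambda>k. - r k)) / (real N + 1)"
  have "Min (range (\<lambda>k. - r k)) \<in> range (\<lambda>k. - r k)"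
    by (intro Min_in) auto
  then have "Min (range (\<lambda>k. - r k)) > 0"
    using v(2) by (auto simp: r_def)
  then have e: "e > 0" by (simp add: e_def)
  have eN: "real N * e \<le> - r k" for k
  proof -
    have "real N * e \<le> (real N + 1) * e" using e by simp
    also have "\<dots> = Min (range (\<lambda>k. - r k))" by (simp add: e_def)
    also have "\<dots> \<le> - r k" by (intro Min_le) auto
    finally show ?thesis .
  qed
  define q where "q i = (\<chi> k. ((v v* S i) $ k + e) / w $ k)" for i
  have p: "p $ k > 0" for k
    by (simp add: p_def v w)
  have pw: "diagm p *v w = v"
    using w(1) by (auto simp: vec_eq_iff diagm_mult_vec p_def less_imp_neq[symmetric])
  have vS: "(v v* S i) $ k \<ge> 0" if "i < N" for i k
    unfolding vector_matrix_mult_nth by (intro sum_nonneg mult_nonneg_nonneg S[OF that] less_imp_le[OF v(1)])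
  have q: "q i $ k > 0" if "i < N" for i k
    using vS[OF that, of k] e w(1) by (simp add: q_def)
  have "neg_def (riccati A S N p q)"
  proof (rule symmetric_metzler_neg_def)
    show "metzler (riccati A S N p q)"
      by (rule metzler_riccati[OF A S p q])
    show "riccati A S N p q $ i $ j = riccati A S N p q $ j $ i" for i j
      by (rule riccati_sym)
    show "w $ k > 0" for k by (rule w)
    fix k
    define z where "z i = diagm (\<chi> k. inverse (q i $ k)) *v (v v* S i)" for i
    have z: "z i $ j \<le> w $ j" if "i < N" for i j
      using vS[OF that, of j] w(1)[of j] e
      by (simp add: z_def diagm_mult_vec q_def field_simps)
    have Sz: "(S i *v z i) $ k \<le> (S i *v w) $ k" if "i < N" for i
      unfolding matrix_vector_mult_nth by (intro sum_mono mult_left_mono z S that)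
    have "(riccati A S N p q *v w) $ k = (v v* A) $ k + p $ k * (A *v w) $ k +
        (\<Sum>i<N. q i $ k * w $ k + p $ k * (S i *v z i) $ k)"
      by (simp add: riccati_mult_vec pw z_def)
    also have "\<dots> \<le> (v v* A) $ k + p $ k * (A *v w) $ k +
        (\<Sum>i<N. ((v v* S i) $ k + e) + p $ k * (S i *v w) $ k)"
      using w(1)[of k]
      by (intro add_left_mono sum_mono add_mono mult_left_mono less_imp_le[OF p] Sz) (auto simp: q_def)
    also have "\<dots> = r k + real N * e + p $ k * ((A + (\<Sum>i<N. S i)) *v w) $ k"
    proof -
      have "v v* (\<Sum>i<N. S i) = (\<Sum>i<N. v v* S i)"
        by (induction N) (auto simp: vector_matrix_mult_add_rdistrib)
      then show ?thesis
        by (simp add: r_def vector_matrix_mult_add_rdistrib matrix_vector_mult_add_rdistrib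
            matrix_vector_mult_sum sum.distrib sum_distrib_left distrib_left)
    qed
    also have "\<dots> < 0"
      using eN[of k] mult_pos_neg[OF p w(2), of k k] by simp
    finally show "(riccati A S N p q *v w) $ k < 0" .
  qed
  then show ?thesis using p q by blast
qed

text \<open>Suppose \<open>x\<close> is an eigenvector for some \<open>r\<close> at least 0 and let
  \<open>y = P x\<close>. Completing squares with \<open>u = y v* S i\<close> gives \<open>2 (u
  \<bullet> x) \<le> x \<bullet> Q x + u \<bullet> Q^{-1} u\<close>, so the nonnegative number
  \<open>2 r (y \<bullet> x)\<close> is bounded by the negative Riccati form at
  \<open>x\<close>.\<close>

lemma riccati_neg_def_imp_dual_stable:
  fixes A :: "real^'n^'n"
  assumes M: "metzler (A + (\<Sum>i<N. S i))"
    and p: "\<And>k. p $ k > 0" and q: "\<And>i k. i < N \<Longrightarrow> q i $ k > 0"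
    and neg: "neg_def (riccati A S N p q)"
  shows "dual_stable (A + (\<Sum>i<N. S i))"
proof (rule dual_stable_of_no_real_eigenvalue[OF M])
  fix r :: real and x :: "real^'n" assume r: "r \<ge> 0" and x: "x \<noteq> 0"
  show "(A + (\<Sum>i<N. S i)) *v x \<noteq> r *\<^sub>R x"
  proof
    assume eig: "(A + (\<Sum>i<N. S i)) *v x = r *\<^sub>R x"
    define y where "y = diagm p *v x"
    define z where "z i = diagm (\<chi> k. inverse (q i $ k)) *v (y v* S i)" for i
    have inner_p: "x \<bullet> (\<chi> k. p $ k * u $ k) = y \<bullet> u" for u
      by (simp add: inner_vec_def y_def diagm_mult_vec mult_ac)
    have "0 \<le> 2 * (r * (y \<bullet> x))"
    proof -
      have "0 \<le> y \<bullet> x"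
        unfolding inner_vec_def y_def diagm_mult_vec
        by (auto intro!: sum_nonneg simp: mult.assoc less_imp_le[OF p])
      then show ?thesis using r by simp
    qed
    also have "\<dots> = 2 * (y \<bullet> ((A + (\<Sum>i<N. S i)) *v x))"
      by (simp add: eig)
    also have "\<dots> = 2 * (y \<bullet> (A *v x)) + (\<Sum>i<N. 2 * (y \<bullet> (S i *v x)))"
      by (simp add: matrix_vector_mult_add_rdistrib matrix_vector_mult_sum inner_add_right inner_sum_right
          sum_distrib_left)
    also have "\<dots> \<le> 2 * (y \<bullet> (A *v x)) + (\<Sum>i<N. (\<Sum>k\<in>UNIV. q i $ k * (x $ k)\<^sup>2) + y \<bullet> (S i *v z i))"
    proof (intro add_left_mono sum_mono)
      fix i assume i: "i \<in> {..<N}"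
      define u where "u = y v* S i"
      have "2 * (u $ k * x $ k) \<le> q i $ k * (x $ k)\<^sup>2 + u $ k * z i $ k" for k
      proof -
        have qk: "q i $ k > 0" using q i by simp
        have "0 \<le> (q i $ k * x $ k - u $ k)\<^sup>2 / q i $ k" using qk by simp
        also have "\<dots> = q i $ k * (x $ k)\<^sup>2 + u $ k * z i $ k - 2 * (u $ k * x $ k)"
          using qk by (simp add: z_def diagm_mult_vec u_def[symmetric] field_simps power2_eq_square)
        finally show ?thesis by simp
      qed
      then have "(\<Sum>k\<in>UNIV. 2 * (u $ k * x $ k)) \<le> (\<Sum>k\<in>UNIV. q i $ k * (x $ k)\<^sup>2 + u $ k * z i $ k)"
        by (intro sum_mono)
      then have "2 * (u \<bullet> x) \<le> (\<Sum>k\<in>UNIV. q i $ k * (x $ k)\<^sup>2) + u \<bullet> z i"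
        by (simp add: inner_vec_def sum.distrib sum_distrib_left)
      then show "2 * (y \<bullet> (S i *v x)) \<le> (\<Sum>k\<in>UNIV. q i $ k * (x $ k)\<^sup>2) + y \<bullet> (S i *v z i)"
        by (simp add: u_def dot_lmul_matrix)
    qed
    also have "\<dots> = x \<bullet> (riccati A S N p q *v x)"
    proof -
      have "riccati A S N p q *v x = y v* A + (\<chi> k. p $ k * (A *v x) $ k) +
          (\<Sum>i<N. (\<chi> k. q i $ k * x $ k) + (\<chi> k. p $ k * (S i *v z i) $ k))"
        by (simp add: vec_eq_iff riccati_mult_vec y_def z_def)
      then have "x \<bullet> (riccati A S N p q *v x) = y \<bullet> (A *v x) + y \<bullet> (A *v x) +
          (\<Sum>i<N. x \<bullet> (\<chi> k. q i $ k * x $ k) + y \<bullet> (S i *v z i))"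
        by (simp add: inner_add_right inner_sum_right inner_p inner_commute[of x "y v* A"] dot_lmul_matrix)
      moreover have "x \<bullet> (\<chi> k. q i $ k * x $ k) = (\<Sum>k\<in>UNIV. q i $ k * (x $ k)\<^sup>2)" for i
        by (simp add: inner_vec_def power2_eq_square mult_ac)
      ultimately show ?thesis by simp
    qed
    also have "\<dots> < 0"
      using neg x by (simp add: neg_def_def)
    finally show False by simp
  qed
qed

section \<open>Positive systems with distributed delays\<close>

text \<open>Nonnegativity upgrades gauge integrability to absolute integrability, which survives
  multiplication by a bounded measurable function.\<close>

lemma integrable_nonneg_mult_continuous:
  fixes a g :: "real \<Rightarrow> real"
  assumes a: "a integrable_on {b..c}" "\<And>t. t \<in> {b..c} \<Longrightarrow> a t \<ge> 0"
    and g: "continuous_on {b..c} g"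
  shows "(\<lambda>t. a t * g t) integrable_on {b..c}"
proof -
  have "(\<lambda>t. g t * a t) absolutely_integrable_on {b..c}"
  proof (rule absolutely_integrable_bounded_measurable_product_real)
    show "g \<in> borel_measurable (lebesgue_on {b..c})"
      by (rule continuous_imp_measurable_on_sets_lebesgue[OF g]) auto
    show "bounded (g ` {b..c})"
      by (rule compact_imp_bounded[OF compact_continuous_image[OF g]]) auto
    show "a absolutely_integrable_on {b..c}"
      by (rule nonnegative_absolutely_integrable_1[OF a])
  qed auto
  then show ?thesis
    by (simp add: mult.commute set_lebesgue_integral_eq_integral(1))
qed

lemma integrable_vec:
  fixes f :: "'a::euclidean_space \<Rightarrow> ('b::euclidean_space)^'n"
  assumes "\<And>i. (\<lambda>t. f t $ i) integrable_on S"
  shows "f integrable_on S"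
proof (subst integrable_componentwise_iff, intro ballI)
  fix b :: "'b^'n" assume "b \<in> Basis"
  then obtain u i where b: "b = axis i u" by (auto simp: Basis_vec_def)
  have "(\<lambda>t. f t $ i \<bullet> u) integrable_on S"
    using assms by (rule integrable_component)
  then show "(\<lambda>t. f t \<bullet> b) integrable_on S"
    by (simp add: b inner_axis)
qed

lemma integrable_vec_nth:
  fixes f :: "'a::euclidean_space \<Rightarrow> ('b::euclidean_space)^'n"
  assumes "f integrable_on S"
  shows "(\<lambda>t. f t $ i) integrable_on S" "integral S (\<lambda>t. f t $ i) = integral S f $ i"
  using integrable_linear[OF assms bounded_linear_vec_nth[of i]]
    integral_linear[OF assms bounded_linear_vec_nth[of i]]
  by (auto simp: o_def)

lemma integrable_matrix_nth:
  fixes F :: "real \<Rightarrow> real^'n^'m"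
  assumes "F integrable_on S"
  shows "(\<lambda>t. F t $ i $ j) integrable_on S" "integral S (\<lambda>t. F t $ i $ j) = integral S F $ i $ j"
  using integrable_vec_nth[OF assms, of i] integrable_vec_nth[OF integrable_vec_nth(1)[OF assms], of i j]
  by auto

text \<open>A nonnegative mixture of the convex functions \<open>l \<mapsto> exp (l * t)\<close> is
  convex, and a finite convex function on the line is continuous.\<close>

lemma continuous_on_laplace:
  fixes a :: "real \<Rightarrow> real"
  assumes a: "a integrable_on {b..c}" "\<And>t. t \<in> {b..c} \<Longrightarrow> a t \<ge> 0"
  shows "continuous_on UNIV (\<lambda>l. integral {b..c} (\<lambda>t. a t * exp (l * t)))"
proof (rule convex_on_continuous)
  have int: "(\<lambda>t. a t * exp (l * t)) integrable_on {b..c}" for l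
    by (intro integrable_nonneg_mult_continuous a continuous_intros)
  show "convex_on UNIV (\<lambda>l. integral {b..c} (\<lambda>t. a t * exp (l * t)))"
  proof (rule convex_onI)
    fix s x y :: real assume s: "0 < s" "s < 1"
    have int': "(\<lambda>t. k * (a t * exp (l * t))) integrable_on {b..c}" for k l
      using integrable_cmul[OF int, of k l] by simp
    have "integral {b..c} (\<lambda>t. a t * exp (((1 - s) *\<^sub>R x + s *\<^sub>R y) * t)) \<le>
        integral {b..c} (\<lambda>t. (1 - s) * (a t * exp (x * t)) + s * (a t * exp (y * t)))"
    proof (rule integral_le)
      fix t assume t: "t \<in> {b..c}"
      have "exp ((1 - s) *\<^sub>R (x * t) + s *\<^sub>R (y * t)) \<le> (1 - s) * exp (x * t) + s * exp (y * t)"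
        using s by (intro convex_onD[OF exp_convex]) auto
      from mult_left_mono[OF this a(2)[OF t]]
      show "a t * exp (((1 - s) *\<^sub>R x + s *\<^sub>R y) * t) \<le>
          (1 - s) * (a t * exp (x * t)) + s * (a t * exp (y * t))"
        by (simp add: algebra_simps)
    qed (intro int integrable_add int')+
    also have "\<dots> = (1 - s) * integral {b..c} (\<lambda>t. a t * exp (x * t)) +
        s * integral {b..c} (\<lambda>t. a t * exp (y * t))"
      by (simp add: integral_add[OF int' int'])
    finally show "integral {b..c} (\<lambda>t. a t * exp (((1 - s) *\<^sub>R x + s *\<^sub>R y) * t)) \<le>
        (1 - s) * integral {b..c} (\<lambda>t. a t * exp (x * t)) +
        s * integral {b..c} (\<lambda>t. a t * exp (y * t))" .
  qed auto
qed auto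

section \<open>The delay system and its characteristic matrices\<close>

locale positive_delay_system =
  fixes A0 :: "real^'n^'n" and A :: "nat \<Rightarrow> real \<Rightarrow> real^'n^'n"
    and h :: "nat \<Rightarrow> real" and N :: nat
  assumes metzler_A0: "metzler A0"
    and A_integrable: "i < N \<Longrightarrow> A i integrable_on {- h i..0}"
    and A_nonneg: "i < N \<Longrightarrow> \<theta> \<in> {- h i..0} \<Longrightarrow> A i \<theta> $ j $ k \<ge> 0"
begin

definition delay_term :: "(real \<Rightarrow> real^'n) \<Rightarrow> real \<Rightarrow> real^'n" where
  "delay_term x t = (\<Sum>i<N. integral {- h i..0} (\<lambda>\<theta>. A i \<theta> *v x (t + \<theta>)))"

definition laplace :: "nat \<Rightarrow> real \<Rightarrow> real^'n^'n" where
  "laplace i l = integral {- h i..0} (\<lambda>\<theta>. exp (l * \<theta>) *\<^sub>R A i \<theta>)"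

text \<open>Its kernel consists of the amplitudes \<open>w\<close> of solutions
  \<open>exp (l * t) *\<^sub>R w\<close>; at \<open>l = 0\<close> it is the matrix of condition
  (ii).\<close>

definition char_mat :: "real \<Rightarrow> real^'n^'n" where
  "char_mat l = A0 + (\<Sum>i<N. laplace i l) - l *\<^sub>R mat 1"

lemma is_solution_iff:
  "is_solution A0 A h N x \<longleftrightarrow> continuous_on {- max_delay h N..} x \<and>
     (\<forall>t\<ge>0. (x has_vector_derivative (A0 *v x t + delay_term x t)) (at t within {0..}))"
  by (simp add: is_solution_def delay_term_def)

lemma max_delay: "max_delay h N \<ge> 0" "i < N \<Longrightarrow> h i \<le> max_delay h N"
  unfolding max_delay_def by (auto intro!: Max_ge)

lemma exp_A_integrable:
  assumes i: "i < N"
  shows "(\<lambda>\<theta>. exp (l * \<theta>) *\<^sub>R A i \<theta>) integrable_on {- h i..0}"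
proof (intro integrable_vec)
  fix j k
  have "(\<lambda>\<theta>. A i \<theta> $ j $ k * exp (l * \<theta>)) integrable_on {- h i..0}"
    by (intro integrable_nonneg_mult_continuous integrable_matrix_nth A_integrable A_nonneg i continuous_intros)
  then show "(\<lambda>\<theta>. (exp (l * \<theta>) *\<^sub>R A i \<theta>) $ j $ k) integrable_on {- h i..0}"
    by (simp add: mult.commute)
qed

lemma laplace_nth:
  assumes i: "i < N"
  shows "laplace i l $ j $ k = integral {- h i..0} (\<lambda>\<theta>. A i \<theta> $ j $ k * exp (l * \<theta>))"
  using integrable_matrix_nth(2)[OF exp_A_integrable[OF i], of l j k]
  by (simp add: laplace_def mult.commute)

lemma laplace_nonneg: "i < N \<Longrightarrow> laplace i l $ j $ k \<ge> 0"
  unfolding laplace_nth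
  by (intro integral_nonneg integrable_nonneg_mult_continuous integrable_matrix_nth A_integrable A_nonneg
      mult_nonneg_nonneg continuous_intros) auto

lemma laplace_antimono:
  assumes i: "i < N" and l: "l \<ge> 0"
  shows "laplace i l $ j $ k \<le> laplace i 0 $ j $ k"
  unfolding laplace_nth[OF i]
proof (rule integral_le)
  fix \<theta> assume \<theta>: "\<theta> \<in> {- h i..0}"
  then have "l * \<theta> \<le> 0 * \<theta>" using l by (simp add: mult_nonneg_nonpos)
  then show "A i \<theta> $ j $ k * exp (l * \<theta>) \<le> A i \<theta> $ j $ k * exp (0 * \<theta>)"
    by (intro mult_left_mono A_nonneg[OF i \<theta>]) simp
qed (intro integrable_nonneg_mult_continuous integrable_matrix_nth A_integrable A_nonneg i continuous_intros; simp)+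

lemma continuous_on_char_mat: "continuous_on S char_mat"
proof -
  have "continuous_on UNIV (laplace i)" if i: "i < N" for i
  proof -
    have "continuous_on UNIV (\<lambda>l. \<chi> j k. integral {- h i..0} (\<lambda>\<theta>. A i \<theta> $ j $ k * exp (l * \<theta>)))"
      by (intro continuous_on_vec_lambda continuous_on_laplace integrable_matrix_nth A_integrable A_nonneg i)
    moreover have "laplace i = (\<lambda>l. \<chi> j k. integral {- h i..0} (\<lambda>\<theta>. A i \<theta> $ j $ k * exp (l * \<theta>)))"
      by (simp add: fun_eq_iff vec_eq_iff laplace_nth[OF i])
    ultimately show ?thesis by simp
  qed
  then have "continuous_on UNIV char_mat"
    unfolding char_mat_def by (intro continuous_intros) auto
  then show ?thesis by (rule continuous_on_subset) simp
qed

lemma metzler_char_mat: "metzler (char_mat l)"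
proof -
  have "metzler (A0 + (\<Sum>i<N. laplace i l))"
    using metzler_A0 by (auto simp: metzler_def intro!: add_nonneg_nonneg sum_nonneg laplace_nonneg)
  then show ?thesis
    unfolding char_mat_def by (rule metzler_minus_mat)
qed

text \<open>The shift \<open>b\<close> is chosen from the transforms at 0. These dominate the
  transforms at \<open>b\<close>, which avoids a circular choice.\<close>

lemma dual_stable_char_mat_large: "\<exists>b\<ge>0. dual_stable (char_mat b)"
proof -
  obtain b where b: "b \<ge> 0" "\<And>k. b > (\<Sum>j\<in>UNIV. (A0 + (\<Sum>i<N. laplace i 0)) $ j $ k)"
    using ex_bound_column_sums by metis
  have "(\<Sum>j\<in>UNIV. (A0 + (\<Sum>i<N. laplace i b)) $ j $ k) < b" for k
  proof -
    have "(\<Sum>j\<in>UNIV. (A0 + (\<Sum>i<N. laplace i b)) $ j $ k) \<le> (\<Sum>j\<in>UNIV. (A0 + (\<Sum>i<N. laplace i 0)) $ j $ k)"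
      using b(1) by (auto intro!: sum_mono laplace_antimono)
    then show ?thesis using b(2)[of k] by simp
  qed
  then have "dual_stable (char_mat b)"
    unfolding char_mat_def by (intro dual_stable_minus_mat)
  with b(1) show ?thesis by blast
qed

section \<open>Exponential solutions\<close>

lemma delay_term_exp:
  "delay_term (\<lambda>t. exp (l * t) *\<^sub>R w) t = exp (l * t) *\<^sub>R ((\<Sum>i<N. laplace i l) *v w)"
proof -
  have "integral {- h i..0} (\<lambda>\<theta>. A i \<theta> *v (exp (l * (t + \<theta>)) *\<^sub>R w)) = exp (l * t) *\<^sub>R (laplace i l *v w)"
    if i: "i < N" for i
  proof -
    have "linear (\<lambda>M::real^'n^'n. exp (l * t) *\<^sub>R (M *v w))"
      by (auto simp: linear_iff matrix_vector_mult_add_rdistrib scaleR_add_right scaleR_matrix_vector_assoc[symmetric])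
    then have bl: "bounded_linear (\<lambda>M::real^'n^'n. exp (l * t) *\<^sub>R (M *v w))"
      by (rule linear_conv_bounded_linear[THEN iffD1])
    have "integral {- h i..0} (\<lambda>\<theta>. exp (l * t) *\<^sub>R ((exp (l * \<theta>) *\<^sub>R A i \<theta>) *v w)) = exp (l * t) *\<^sub>R (laplace i l *v w)"
      using integral_linear[OF exp_A_integrable[OF i] bl] by (simp add: o_def laplace_def)
    then show ?thesis
      by (simp add: distrib_left exp_add matrix_vector_mult_scaleR scaleR_matrix_vector_assoc[symmetric])
  qed
  then show ?thesis
    by (simp add: delay_term_def matrix_vector_mult_sum scaleR_sum_right)
qed

text \<open>The residual of an exponential in the delay equation: zero yields a solution, a negative
  vector yields a strict supersolution.\<close>

lemma char_mat_mult_vec: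
  "exp (l * t) *\<^sub>R (char_mat l *v w) =
     A0 *v (exp (l * t) *\<^sub>R w) + delay_term (\<lambda>t. exp (l * t) *\<^sub>R w) t - l *\<^sub>R exp (l * t) *\<^sub>R w"
  by (simp add: char_mat_def delay_term_exp mat_vector_mult_real matrix_vector_mult_add_rdistrib
      matrix_vector_mult_scaleR scaleR_right_distrib scaleR_diff_right mult.commute[of l "exp _"])

lemma exp_has_vector_derivative:
  "((\<lambda>t. exp (l * t) *\<^sub>R w) has_vector_derivative l *\<^sub>R exp (l * t) *\<^sub>R (w::real^'n)) (at t within S)"
  by (auto intro!: derivative_eq_intros simp: mult.commute)

lemma exp_is_solution:
  assumes "char_mat l *v w = 0"
  shows "is_solution A0 A h N (\<lambda>t. exp (l * t) *\<^sub>R w)"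
  unfolding is_solution_iff
proof (intro conjI allI impI)
  fix t :: real
  have "l *\<^sub>R exp (l * t) *\<^sub>R w = A0 *v (exp (l * t) *\<^sub>R w) + delay_term (\<lambda>t. exp (l * t) *\<^sub>R w) t"
    using char_mat_mult_vec[of l t w] assms by simp
  then show "((\<lambda>t. exp (l * t) *\<^sub>R w) has_vector_derivative
      A0 *v (exp (l * t) *\<^sub>R w) + delay_term (\<lambda>t. exp (l * t) *\<^sub>R w) t) (at t within {0..})"
    using exp_has_vector_derivative[of l w t "{0..}"] by simp
qed (intro continuous_intros)

text \<open>Going down from a large \<open>b\<close> to 0, a singular characteristic matrix would
  produce a solution whose norm never drops below \<open>norm w\<close>, contradicting convergence
  to zero.\<close>

lemma asymp_stable_imp_dual_stable:
  assumes stable: "asymp_stable A0 A h N"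
  shows "dual_stable (char_mat 0)"
proof -
  obtain b where b: "b \<ge> 0" "dual_stable (char_mat b)"
    using dual_stable_char_mat_large by blast
  show ?thesis
  proof (rule dual_stable_path[OF continuous_on_char_mat b(1) metzler_char_mat _ b(2)])
    fix l assume l: "l \<in> {0..b}"
    show "det (char_mat l) \<noteq> 0"
    proof
      assume "det (char_mat l) = 0"
      then obtain w where w: "w \<noteq> 0" "char_mat l *v w = 0"
        by (auto simp: det_eq_0_iff_ker)
      then have "((\<lambda>t. exp (l * t) *\<^sub>R w) \<longlongrightarrow> 0) at_top"
        using stable exp_is_solution by (auto simp: asymp_stable_def)
      then have "eventually (\<lambda>t. dist (exp (l * t) *\<^sub>R w) 0 < norm w) at_top"
        using w(1) by (intro tendstoD) auto
      then have "eventually (\<lambda>t. dist (exp (l * t) *\<^sub>R w) 0 < norm w \<and> t \<ge> 0) at_top"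
        using eventually_ge_at_top[of 0] by (rule eventually_conj)
      then obtain t where t: "t \<ge> 0" "norm (exp (l * t) *\<^sub>R w) < norm w"
        by (auto dest!: eventually_happens)
      have "1 * norm w \<le> exp (l * t) * norm w"
        using l t(1) by (intro mult_right_mono) auto
      with t(2) show False by simp
    qed
  qed
qed

section \<open>Comparison with strict supersolutions\<close>

lemma delay_integrable:
  assumes x: "continuous_on {- max_delay h N..} x" and t: "t \<ge> 0" and i: "i < N"
  shows "(\<lambda>\<theta>. A i \<theta> *v x (t + \<theta>)) integrable_on {- h i..0}"
proof (rule integrable_vec)
  fix j
  have cont: "continuous_on {- h i..0} (\<lambda>\<theta>. x (t + \<theta>) $ k)" for k
    using max_delay(2)[OF i] t
    by (intro continuous_intros continuous_on_compose2[OF x]) auto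
  show "(\<lambda>\<theta>. (A i \<theta> *v x (t + \<theta>)) $ j) integrable_on {- h i..0}"
    unfolding matrix_vector_mult_nth
    by (intro integrable_sum integrable_nonneg_mult_continuous integrable_matrix_nth A_integrable
        A_nonneg i cont) auto
qed

lemma delay_term_diff:
  assumes "continuous_on {- max_delay h N..} x" "continuous_on {- max_delay h N..} y" "t \<ge> 0"
  shows "delay_term (\<lambda>s. x s - y s) t = delay_term x t - delay_term y t"
  by (simp add: delay_term_def matrix_vector_mult_diff_distrib integral_diff delay_integrable[OF assms(1,3)]
      delay_integrable[OF assms(2,3)] sum_subtractf)

lemma delay_term_nonneg:
  assumes x: "continuous_on {- max_delay h N..} x" and t: "t \<ge> 0"
    and nonneg: "\<And>s k. s \<in> {- max_delay h N..t} \<Longrightarrow> x s $ k \<ge> 0"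
  shows "delay_term x t $ j \<ge> 0"
proof -
  have "integral {- h i..0} (\<lambda>\<theta>. A i \<theta> *v x (t + \<theta>)) $ j \<ge> 0" if i: "i < N" for i
    unfolding integrable_vec_nth(2)[OF delay_integrable[OF x t i], symmetric]
  proof (rule integral_nonneg)
    show "(\<lambda>\<theta>. (A i \<theta> *v x (t + \<theta>)) $ j) integrable_on {- h i..0}"
      by (rule integrable_vec_nth(1)[OF delay_integrable[OF x t i]])
    show "0 \<le> (A i \<theta> *v x (t + \<theta>)) $ j" if "\<theta> \<in> {- h i..0}" for \<theta>
      unfolding matrix_vector_mult_nth using that max_delay(2)[OF i] t
      by (intro sum_nonneg mult_nonneg_nonneg A_nonneg i nonneg) auto
  qed
  then show ?thesis
    by (auto simp: delay_term_def intro!: sum_nonneg)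
qed

text \<open>At a first zero of a component \<open>j\<close> all other components are nonnegative, so the strict
  inequality makes that component increase there, contradicting positivity just before.\<close>

lemma strict_supersolution_pos:
  assumes y: "continuous_on {- max_delay h N..} y"
    and der: "\<And>t. t \<ge> 0 \<Longrightarrow> (y has_vector_derivative d t) (at t within {0..})"
    and super: "\<And>t j. t \<ge> 0 \<Longrightarrow> d t $ j > (A0 *v y t + delay_term y t) $ j"
    and init: "\<And>t j. t \<in> {- max_delay h N..0} \<Longrightarrow> y t $ j > 0"
    and t: "t \<ge> 0"
  shows "y t $ j > 0"
proof (rule ccontr)
  assume neg: "\<not> y t $ j > 0"
  have cont: "continuous_on {0..t} (\<lambda>s. y s $ k)" for k
    by (intro continuous_intros continuous_on_subset[OF y]) (use max_delay(1) in auto)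
  \<comment> \<open>The times at which some component is nonpositive. As a finite union of closed
    sets \<open>Z\<close> contains its infimum, the first crossing time.\<close>
  define Z where "Z = (\<Union>k. {s \<in> {0..t}. y s $ k \<le> 0})"
  have "closed {s \<in> {0..t}. y s $ k \<le> 0}" for k
    by (intro continuous_on_closed_Collect_le cont continuous_intros)
  then have "closed Z" unfolding Z_def by (intro closed_UN) auto
  moreover have "t \<in> Z" using neg t by (auto simp: Z_def intro!: exI[of _ j])
  moreover have bdd: "bdd_below Z" by (auto simp: Z_def bdd_below_def)
  ultimately have "Inf Z \<in> Z" by (intro closed_contains_Inf) auto
  define s where "s = Inf Z"
  obtain k where k: "s \<in> {0..t}" "y s $ k \<le> 0"
    using \<open>Inf Z \<in> Z\<close> by (auto simp: Z_def s_def)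
  have s0: "s > 0"
    using init[of 0 k] k max_delay(1) by (cases "s = 0") auto
  have before: "y r $ m > 0" if "- max_delay h N \<le> r" "r < s" for r m
  proof (cases "r \<le> 0")
    case True
    then show ?thesis using init that by auto
  next
    case False
    show ?thesis
    proof (rule ccontr)
      assume "\<not> y r $ m > 0"
      then have "r \<in> Z" using False that k(1) by (auto simp: Z_def intro!: exI[of _ m])
      then have "s \<le> r" unfolding s_def by (rule cInf_lower[OF _ bdd])
      with that show False by simp
    qed
  qed
  \<comment> \<open>At \<open>s\<close> itself the sign passes to the limit from the left.\<close>
  have nonneg: "y r $ m \<ge> 0" if "r \<in> {- max_delay h N..s}" for r m
  proof (cases "r = s")
    case True
    have cl: "closure {0..<s} = {0..s}" using s0 by simp
    have "y s $ m \<ge> 0"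
    proof (rule continuous_ge_on_closure[of "{0..<s}" "\<lambda>s. y s $ m"])
      show "continuous_on (closure {0..<s}) (\<lambda>s. y s $ m)"
        unfolding cl using k(1) by (intro continuous_on_subset[OF cont]) auto
      show "s \<in> closure {0..<s}" unfolding cl using s0 by simp
      show "0 \<le> y r $ m" if "r \<in> {0..<s}" for r
        using before[of r m] that max_delay(1) by simp
    qed
    then show ?thesis by (simp add: True)
  next
    case False
    then show ?thesis using before[of r m] that by simp
  qed
  have yk: "y s $ k = 0"
    using k(2) nonneg[of s k] s0 max_delay(1) by auto
  have "0 \<le> (A0 *v y s) $ k"
    unfolding matrix_vector_mult_nth
  proof (rule sum_nonneg)
    fix m show "0 \<le> A0 $ k $ m * y s $ m"
    proof (cases "m = k")
      case False
      then show ?thesis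
        using metzler_A0 nonneg[of s m] s0 max_delay(1) by (auto simp: metzler_def)
    qed (simp add: yk)
  qed
  moreover have "0 \<le> delay_term y s $ k"
    by (rule delay_term_nonneg[OF y _ nonneg]) (use s0 in auto)
  ultimately have dk: "d s $ k > 0"
    using super[of s k] s0 by simp
  have "((\<lambda>s. y s $ k) has_vector_derivative d s $ k) (at s within {0..})"
    using bounded_linear.has_vector_derivative[OF bounded_linear_vec_nth der[of s]] s0 by simp
  then have "((\<lambda>s. y s $ k) has_real_derivative d s $ k) (at s within {0..})"
    by (simp add: has_real_derivative_iff_has_vector_derivative)
  from has_real_derivative_pos_inc_left[OF this dk] obtain e where
    e: "e > 0" "\<And>r. r > 0 \<Longrightarrow> s - r \<in> {0..} \<Longrightarrow> r < e \<Longrightarrow> y (s - r) $ k < y s $ k"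
    by blast
  \<comment> \<open>The minimum with \<open>s\<close> keeps \<open>s - r\<close> in the half-line on
    which the one-sided derivative is taken.\<close>
  define r where "r = min (e / 2) s"
  have "y (s - r) $ k < 0"
    using e(1) s0 e(2)[of r] by (auto simp: r_def yk)
  moreover have "y (s - r) $ k > 0"
    using e(1) s0 max_delay(1) by (intro before) (auto simp: r_def)
  ultimately show False by simp
qed

text \<open>By linearity the exponential minus the solution inherits the strict residual of the
  exponential, so it stays positive.\<close>

lemma solution_less_exp:
  assumes x: "is_solution A0 A h N x"
    and w: "\<And>j. (char_mat l *v w) $ j < 0"
    and init: "\<And>t j. t \<in> {- max_delay h N..0} \<Longrightarrow> x t $ j < exp (l * t) * w $ j"
    and t: "t \<ge> 0"
  shows "x t $ j < exp (l * t) * w $ j"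
proof -
  define u where "u s = exp (l * s) *\<^sub>R w" for s
  have contu: "continuous_on {- max_delay h N..} u"
    unfolding u_def by (intro continuous_intros)
  have contx: "continuous_on {- max_delay h N..} x"
    using x by (simp add: is_solution_iff)
  have "(\<lambda>s. u s - x s) t $ j > 0"
  proof (rule strict_supersolution_pos[OF _ _ _ _ t])
    show "continuous_on {- max_delay h N..} (\<lambda>s. u s - x s)"
      by (intro continuous_intros contu contx)
    show "((\<lambda>s. u s - x s) has_vector_derivative (l *\<^sub>R u s - (A0 *v x s + delay_term x s))) (at s within {0..})"
      if "s \<ge> 0" for s
      using x that exp_has_vector_derivative[of l w s "{0..}"]
      by (intro has_vector_derivative_diff) (auto simp: is_solution_iff u_def)
    show "(A0 *v (u s - x s) + delay_term (\<lambda>s. u s - x s) s) $ j < (l *\<^sub>R u s - (A0 *v x s + delay_term x s)) $ j"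
      if "s \<ge> 0" for s j
    proof -
      have "(exp (l * s) *\<^sub>R (char_mat l *v w)) $ j < 0"
        using w[of j] by (simp add: mult_less_0_iff)
      then have "(A0 *v u s + delay_term u s) $ j < (l *\<^sub>R u s) $ j"
        unfolding char_mat_mult_vec u_def by simp
      then show ?thesis
        by (simp add: delay_term_diff[OF contu contx that] matrix_vector_mult_diff_distrib)
    qed
    show "(u s - x s) $ j > 0" if "s \<in> {- max_delay h N..0}" for s j
      using init[OF that, of j] by (simp add: u_def)
  qed
  then show ?thesis by (simp add: u_def)
qed

section \<open>Exponential decay of all solutions\<close>

lemma is_solution_minus:
  assumes "is_solution A0 A h N x"
  shows "is_solution A0 A h N (\<lambda>t. - x t)"
proof -
  have neg: "M *v (- y) = - (M *v y)" for M :: "real^'n^'n" and y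
    by (simp add: vec_eq_iff matrix_vector_mult_nth sum_negf)
  have "delay_term (\<lambda>t. - x t) t = - delay_term x t" for t
    by (simp add: delay_term_def neg sum_negf)
  then have "A0 *v (- x t) + delay_term (\<lambda>t. - x t) t = - (A0 *v x t + delay_term x t)" for t
    by (simp add: neg)
  then show ?thesis
    using assms unfolding is_solution_iff
    by (auto intro!: continuous_intros simp del: minus_add_distrib dest: has_vector_derivative_minus)
qed

text \<open>A supersolution needs a weight acting from the right. Transposition preserves Hurwitz
  stability and so supplies one at \<open>l = 0\<close>; openness then gives one at a slightly
  negative exponent.\<close>

lemma ex_decaying_supersolution:
  assumes "dual_stable (char_mat 0)"
  shows "\<exists>\<mu>>0. \<exists>w. (\<forall>j. w $ j > 0) \<and> (\<forall>j. (char_mat (- \<mu>) *v w) $ j < 0)"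
proof -
  have tr: "metzler (transpose (char_mat l))" for l
    by (simp add: metzler_transpose metzler_char_mat)
  have "dual_stable (transpose (char_mat 0))"
    using assms hurwitz_iff_dual_stable[OF tr] hurwitz_iff_dual_stable[OF metzler_char_mat]
    by (simp add: hurwitz_transpose)
  moreover have "continuous_on UNIV (\<lambda>l. transpose (char_mat l))"
    unfolding transpose_def
    by (intro continuous_on_vec_lambda continuous_on_component continuous_on_char_mat)
  ultimately have "open {l. dual_stable (transpose (char_mat l))}" "0 \<in> {l. dual_stable (transpose (char_mat l))}"
    using open_vimage[OF open_dual_stable, of "\<lambda>l. transpose (char_mat l)"] by (auto simp: vimage_def)
  then obtain e where e: "e > 0" "ball 0 e \<subseteq> {l. dual_stable (transpose (char_mat l))}"
    by (auto simp: open_contains_ball)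
  have "- (e / 2) \<in> ball 0 e" using e(1) by simp
  then have "dual_stable (transpose (char_mat (- (e / 2))))"
    using e(2) by blast
  then show ?thesis
    using e(1) by (auto simp: dual_stable_def intro!: exI[of _ "e / 2"])
qed

text \<open>Both \<open>x\<close> and \<open>- x\<close> are compared with the same exponential. It
  is at least \<open>c * w\<close> on the initial interval, since times there are
  nonpositive.\<close>

lemma solution_exp_bound:
  assumes x: "is_solution A0 A h N x" and \<mu>: "\<mu> > 0" and c: "c > 0"
    and w: "\<And>j. w $ j > 0" "\<And>j. (char_mat (- \<mu>) *v w) $ j < 0"
    and init: "\<And>t j. t \<in> {- max_delay h N..0} \<Longrightarrow> \<bar>x t $ j\<bar> < c * w $ j"
    and t: "t \<ge> 0"
  shows "norm (x t) \<le> exp (- \<mu> * t) * (c * (\<Sum>j\<in>UNIV. w $ j))"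
proof -
  have cw: "(char_mat (- \<mu>) *v (c *\<^sub>R w)) $ j < 0" for j
    using w(2)[of j] c by (simp add: matrix_vector_mult_scaleR mult_less_0_iff)
  have up: "c * w $ j \<le> exp (- \<mu> * s) * (c *\<^sub>R w) $ j" if "s \<in> {- max_delay h N..0}" for s j
  proof -
    have "1 \<le> exp (- \<mu> * s)" using that \<mu> by (simp add: mult_nonneg_nonpos)
    from mult_right_mono[OF this, of "c * w $ j"] show ?thesis
      using c w(1)[of j] by simp
  qed
  have "\<bar>x t $ j\<bar> \<le> exp (- \<mu> * t) * (c * w $ j)" for j
  proof -
    have "x t $ j < exp (- \<mu> * t) * (c *\<^sub>R w) $ j"
    proof (rule solution_less_exp[OF x cw _ t])
      fix s j assume s: "s \<in> {- max_delay h N..0}"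
      show "x s $ j < exp (- \<mu> * s) * (c *\<^sub>R w) $ j"
        using init[OF s, of j] up[OF s, of j] by linarith
    qed
    moreover have "(- x t) $ j < exp (- \<mu> * t) * (c *\<^sub>R w) $ j"
    proof (rule solution_less_exp[OF is_solution_minus[OF x] cw _ t])
      fix s j assume s: "s \<in> {- max_delay h N..0}"
      have "(- x s) $ j = - (x s $ j)" by simp
      then show "(- x s) $ j < exp (- \<mu> * s) * (c *\<^sub>R w) $ j"
        using init[OF s, of j] up[OF s, of j] by linarith
    qed
    ultimately show ?thesis by simp
  qed
  then have "(\<Sum>j\<in>UNIV. \<bar>x t $ j\<bar>) \<le> (\<Sum>j\<in>UNIV. exp (- \<mu> * t) * (c * w $ j))"
    by (intro sum_mono)
  then show ?thesis
    using norm_le_l1_cart[of "x t"] by (simp add: sum_distrib_left)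
qed

lemma dual_stable_imp_asymp_stable:
  assumes "dual_stable (char_mat 0)"
  shows "asymp_stable A0 A h N"
proof -
  obtain \<mu> w where \<mu>: "\<mu> > 0" and w: "\<And>j. w $ j > 0" "\<And>j. (char_mat (- \<mu>) *v w) $ j < 0"
    using ex_decaying_supersolution[OF assms] by blast
  \<comment> \<open>The constants \<open>m\<close> and \<open>W\<close> translate between the norm
    and bounds by multiples of \<open>w\<close>: initial norm below \<open>c * m\<close> gives later
    norm at most \<open>c * W\<close>.\<close>
  define m where "m = Min (range (\<lambda>j. w $ j))"
  have "m \<in> range (\<lambda>j. w $ j)" unfolding m_def by (intro Min_in) auto
  then have m: "m > 0" using w(1) by auto
  have mw: "m \<le> w $ j" for j unfolding m_def by (intro Min_le) auto
  define W where "W = (\<Sum>j\<in>UNIV. w $ j)"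
  have W: "W > 0" unfolding W_def by (intro sum_pos w) auto
  have bound: "norm (x t) \<le> exp (- \<mu> * t) * (c * W)"
    if x: "is_solution A0 A h N x" and c: "c > 0"
      and init: "\<forall>s\<in>{- max_delay h N..0}. norm (x s) < c * m" and t: "t \<ge> 0" for x c t
    unfolding W_def
  proof (rule solution_exp_bound[OF x \<mu> c w _ t])
    fix s j assume "s \<in> {- max_delay h N..0}"
    then have "\<bar>x s $ j\<bar> < c * m"
      using init component_le_norm_cart[of "x s" j] by force
    also have "\<dots> \<le> c * w $ j" using c mw by simp
    finally show "\<bar>x s $ j\<bar> < c * w $ j" .
  qed
  show ?thesis
    unfolding asymp_stable_def
  proof (intro conjI allI impI)
    fix \<epsilon> :: real assume \<epsilon>: "\<epsilon> > 0"
    \<comment> \<open>Half of \<open>\<epsilon>\<close> leaves room for the strict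
      inequality.\<close>
    define c where "c = \<epsilon> / (2 * W)"
    have c: "c > 0" using \<epsilon> W by (simp add: c_def)
    show "\<exists>\<delta>>0. \<forall>x. is_solution A0 A h N x \<and> (\<forall>\<theta>\<in>{- max_delay h N..0}. norm (x \<theta>) < \<delta>) \<longrightarrow>
        (\<forall>t\<ge>0. norm (x t) < \<epsilon>)"
    proof (intro exI[of _ "c * m"] conjI allI impI; (elim conjE)?)
      show "c * m > 0" using c m by simp
      fix x and t :: real
      assume *: "is_solution A0 A h N x" "\<forall>\<theta>\<in>{- max_delay h N..0}. norm (x \<theta>) < c * m" "t \<ge> 0"
      have "exp (- \<mu> * t) * (c * W) \<le> 1 * (c * W)"
        using \<mu> c W *(3) by (intro mult_right_mono) auto
      then have "norm (x t) \<le> c * W" using bound[OF *(1) c *(2,3)] by simp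
      also have "\<dots> < \<epsilon>" using W \<epsilon> by (simp add: c_def)
      finally show "norm (x t) < \<epsilon>" .
    qed
  next
    fix x assume x: "is_solution A0 A h N x"
    have "continuous_on {- max_delay h N..0} x"
      using x by (auto simp: is_solution_iff intro: continuous_on_subset)
    then have "bounded (x ` {- max_delay h N..0})"
      by (intro compact_imp_bounded compact_continuous_image) auto
    then obtain B where B: "B > 0" "\<And>s. s \<in> {- max_delay h N..0} \<Longrightarrow> norm (x s) \<le> B"
      by (auto simp: bounded_pos)
    \<comment> \<open>The added 1 makes the bound \<open>B\<close> on the initial segment
      strict.\<close>
    define c where "c = (B + 1) / m"
    have c: "c > 0" "\<forall>s\<in>{- max_delay h N..0}. norm (x s) < c * m"
      using B m by (force simp: c_def)+
    show "(x \<longlongrightarrow> 0) at_top"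
    proof (rule Lim_null_comparison)
      show "\<forall>\<^sub>F t in at_top. norm (x t) \<le> exp (- \<mu> * t) * (c * W)"
        using eventually_ge_at_top[of 0] by eventually_elim (rule bound[OF x c])
      have "filterlim (\<lambda>t. \<mu> * t) at_top at_top"
        using \<mu> by (intro filterlim_tendsto_pos_mult_at_top[OF tendsto_const] filterlim_ident)
      then have "((\<lambda>t. exp (- \<mu> * t)) \<longlongrightarrow> 0) at_top"
        by (intro filterlim_compose[OF exp_at_bot]) (simp add: filterlim_uminus_at_top)
      then show "((\<lambda>t. exp (- \<mu> * t) * (c * W)) \<longlongrightarrow> 0) at_top"
        by (rule tendsto_mult_left_zero)
    qed
  qed
qed

lemma char_mat_0: "char_mat 0 = A0 + (\<Sum>i<N. integral {- h i..0} (A i))"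
  by (simp add: char_mat_def laplace_def)

lemma asymp_stable_iff: "asymp_stable A0 A h N \<longleftrightarrow> hurwitz (A0 + (\<Sum>i<N. integral {- h i..0} (A i)))"
  using asymp_stable_imp_dual_stable dual_stable_imp_asymp_stable
    hurwitz_iff_dual_stable[OF metzler_char_mat] by (metis char_mat_0)

end

section \<open>The equivalences, each with Hurwitz stability as one side\<close>

theorem theorem18:
  fixes A0 :: "real^'n^'n" and A :: "nat \<Rightarrow> real \<Rightarrow> real^'n^'n"
    and h :: "nat \<Rightarrow> real" and N :: nat
  assumes "metzler A0"
    and "\<And>i. i < N \<Longrightarrow> h i > 0"
    and "\<And>i. i < N \<Longrightarrow> A i integrable_on {- h i..0}"
    and "\<And>i \<theta> j k. i < N \<Longrightarrow> \<theta> \<in> {- h i..0} \<Longrightarrow> A i \<theta> $ j $ k \<ge> 0"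
  defines "Abar \<equiv> \<lambda>i. integral {- h i..0} (A i)"
  shows "(asymp_stable A0 A h N \<longleftrightarrow> hurwitz (A0 + (\<Sum>i<N. Abar i)))
       \<and> (hurwitz (A0 + (\<Sum>i<N. Abar i)) \<longleftrightarrow>
            (\<exists>v::real^'n. (\<forall>j. v $ j > 0) \<and> (\<forall>j. (v v* (A0 + (\<Sum>i<N. Abar i))) $ j < 0)))
       \<and> (hurwitz (A0 + (\<Sum>i<N. Abar i)) \<longleftrightarrow>
            hurwitz A0 \<and> schur_stable (- ((\<Sum>i<N. Abar i) ** matrix_inv A0)))
       \<and> (hurwitz (A0 + (\<Sum>i<N. Abar i)) \<longleftrightarrow>
            (\<exists>P Q. diag_posdef P \<and> (\<forall>i<N. diag_posdef (Q i)) \<and>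
               neg_def (transpose A0 ** P + P ** A0 +
                 (\<Sum>i<N. Q i + P ** Abar i ** matrix_inv (Q i) ** transpose (Abar i) ** P))))"
proof -
  interpret positive_delay_system A0 A h N
    by unfold_locales (use assms in auto)
  have S: "Abar i $ j $ k \<ge> 0" if "i < N" for i j k
    using laplace_nonneg[OF that, of 0 j k] by (simp add: laplace_def Abar_def)
  define M where "M = A0 + (\<Sum>i<N. Abar i)"
  have M: "metzler M"
    using metzler_char_mat[of 0] by (simp add: char_mat_0 M_def Abar_def)
  have riccati: "transpose A0 ** diagm p + diagm p ** A0 +
      (\<Sum>i<N. Q i + diagm p ** Abar i ** matrix_inv (Q i) ** transpose (Abar i) ** diagm p) =
      riccati A0 Abar N p q"
    if "\<And>i. i < N \<Longrightarrow> Q i = diagm (q i)" "\<And>i k. i < N \<Longrightarrow> q i $ k > 0" for p q Q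
  proof -
    have "matrix_inv (Q i) = diagm (\<chi> k. inverse (q i $ k))" if "i < N" for i
      using \<open>\<And>i. i < N \<Longrightarrow> Q i = diagm (q i)\<close>[OF that] \<open>\<And>i k. i < N \<Longrightarrow> q i $ k > 0\<close>[OF that]
      by (simp add: matrix_inv_diagm less_imp_neq[symmetric])
    then show ?thesis
      using that(1) by (simp add: riccati_def)
  qed
  have "asymp_stable A0 A h N \<longleftrightarrow> hurwitz M"
    by (simp add: asymp_stable_iff M_def Abar_def)
  moreover have "hurwitz M \<longleftrightarrow> (\<exists>v::real^'n. (\<forall>j. v $ j > 0) \<and> (\<forall>j. (v v* M) $ j < 0))"
    using hurwitz_iff_dual_stable[OF M] by (simp add: dual_stable_def)
  moreover have "hurwitz M \<longleftrightarrow> hurwitz A0 \<and> schur_stable (- ((\<Sum>i<N. Abar i) ** matrix_inv A0))"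
    unfolding M_def by (intro hurwitz_add_iff metzler_A0) (auto intro!: sum_nonneg S)
  moreover have "hurwitz M \<longleftrightarrow>
      (\<exists>P Q. diag_posdef P \<and> (\<forall>i<N. diag_posdef (Q i)) \<and>
        neg_def (transpose A0 ** P + P ** A0 +
          (\<Sum>i<N. Q i + P ** Abar i ** matrix_inv (Q i) ** transpose (Abar i) ** P)))"
    (is "_ = ?R")
  proof
    assume H: "hurwitz M"
    obtain v where v: "\<And>j. v $ j > 0" "\<And>j. (v v* M) $ j < 0"
      using H hurwitz_iff_dual_stable[OF M] by (auto simp: dual_stable_def)
    \<comment> \<open>The diagonal certificate combines a left and a right weight of
      \<open>M\<close>; the right one comes from the transpose.\<close>
    have "dual_stable (transpose M)"
      using H hurwitz_iff_dual_stable[of "transpose M"] M by (simp add: hurwitz_transpose metzler_transpose)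
    then obtain w where w: "\<And>j. w $ j > 0" "\<And>j. (M *v w) $ j < 0"
      by (auto simp: dual_stable_def)
    obtain p q where pq: "\<And>k. p $ k > 0" "\<And>i k. i < N \<Longrightarrow> q i $ k > 0"
        "neg_def (riccati A0 Abar N p q)"
      using ex_riccati_neg_def[OF metzler_A0 S v(1) v(2)[unfolded M_def] w(1) w(2)[unfolded M_def]] by metis
    have "diag_posdef (diagm p)" "\<forall>i<N. diag_posdef (diagm (q i))"
      using pq(1,2) by (auto simp: diag_posdef_iff)
    then show ?R
      using pq(3) riccati[of "\<lambda>i. diagm (q i)" q p, OF refl pq(2)]
      by (intro exI[of _ "diagm p"] exI[of _ "\<lambda>i. diagm (q i)"]) simp
  next
    assume ?R
    then obtain P Q where PQ: "diag_posdef P" "\<forall>i<N. diag_posdef (Q i)"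
      "neg_def (transpose A0 ** P + P ** A0 +
          (\<Sum>i<N. Q i + P ** Abar i ** matrix_inv (Q i) ** transpose (Abar i) ** P))"
      by blast
    obtain p where p: "\<And>k. p $ k > 0" "P = diagm p"
      using PQ(1) by (auto simp: diag_posdef_iff)
    obtain q where q: "\<And>i k. i < N \<Longrightarrow> q i $ k > 0" "\<And>i. i < N \<Longrightarrow> Q i = diagm (q i)"
      proof -
      \<comment> \<open>The implication makes the claim total in \<open>i\<close>, so that
        \<open>choice\<close> applies; for indices from \<open>N\<close> on any \<open>d\<close>
        will do.\<close>
      have "\<forall>i. \<exists>d. i < N \<longrightarrow> (\<forall>k. d $ k > 0) \<and> Q i = diagm d"
        using PQ(2) by (auto simp: diag_posdef_iff)
      from choice[OF this] show ?thesis using that by blast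
    qed
    have "dual_stable M"
      unfolding M_def
    proof (rule riccati_neg_def_imp_dual_stable)
      show "neg_def (riccati A0 Abar N p q)"
        using PQ(3) by (simp add: p(2) riccati[OF q(2,1)])
    qed (use M p(1) q(1) in \<open>auto simp: M_def\<close>)
    then show "hurwitz M"
      using hurwitz_iff_dual_stable[OF M] by simp
  qed
  ultimately show ?thesis
    unfolding M_def by (intro conjI)
qed

end
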